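(* Let $n\in\mathbb{Z}^+$. Every $n$-periodic $\ell$-pregroup can be embedded in $\mathbf{F}_n(\Omega)$ for some integral chain $\Omega$, i.e. in $\mathbf{F}_n(J\overrightarrow{\times}\mathbb{Z})$ for some chain $J$.
   Context: An $\ell$-pregroup is an algebra $(A,\wedge,\vee,\cdot,{}^{\ell},{}^{r},1)$ with lattice reduct, monoid reduct, order-preserving multiplication, and $x^{\ell}x\le 1\le xx^{\ell}$, $xx^{r}\le 1\le x^{r}x$; it is $n$-periodic if it satisfies $x^{\ell^n}=x^{r^n}$. For a chain $\Omega$, $\mathbf{F}(\Omega)$ is the $\ell$-pregroup of all maps on $\Omega$ having residuals and dual residuals of all orders (residual $f^r(b)=\max\{a:f(a)\le b\}$, dual residual $f^\ell(a)=\min\{b:a\le f(b)\}$), under composition, identity, pointwise order, ${}^\ell,{}^r$; $\mathbf{F}_n(\Omega)$ is its subalgebra of elements with $f^{\ell^n}=f^{r^n}$. $J\overrightarrow{\times}\mathbb{Z}$ is the lexicographic product ($(i,a)\le(j,b)$ iff $i<j$, or $i=j$ and $a\le b$). A chain is integral if it is isomorphic to $J\overrightarrow{\times}\mathbb{Z}$ for some chain $J$. *)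

theory Defs
  imports "HOL-Algebra.Group"
begin

section \<open>\<open>\<ell>\<close>-pregroups\<close>

record 'a lpregroup = "'a monoid" +
  meet_op :: "['a, 'a] \<Rightarrow> 'a"
  join_op :: "['a, 'a] \<Rightarrow> 'a"
  linv :: "'a \<Rightarrow> 'a"
  rinv :: "'a \<Rightarrow> 'a"

definition leq :: "('a, 'm) lpregroup_scheme \<Rightarrow> 'a \<Rightarrow> 'a \<Rightarrow> bool" where
  "leq A x y \<longleftrightarrow> meet_op A x y = x"

locale lpregroup = monoid A for A :: "('a, 'm) lpregroup_scheme" (structure) +
  assumes meet_closed: "\<lbrakk>x \<in> carrier A; y \<in> carrier A\<rbrakk> \<Longrightarrow> meet_op A x y \<in> carrier A"
    and join_closed: "\<lbrakk>x \<in> carrier A; y \<in> carrier A\<rbrakk> \<Longrightarrow> join_op A x y \<in> carrier A"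
    and linv_closed: "x \<in> carrier A \<Longrightarrow> linv A x \<in> carrier A"
    and rinv_closed: "x \<in> carrier A \<Longrightarrow> rinv A x \<in> carrier A"
    and meet_comm: "\<lbrakk>x \<in> carrier A; y \<in> carrier A\<rbrakk> \<Longrightarrow> meet_op A x y = meet_op A y x"
    and join_comm: "\<lbrakk>x \<in> carrier A; y \<in> carrier A\<rbrakk> \<Longrightarrow> join_op A x y = join_op A y x"
    and meet_assoc: "\<lbrakk>x \<in> carrier A; y \<in> carrier A; z \<in> carrier A\<rbrakk>
          \<Longrightarrow> meet_op A (meet_op A x y) z = meet_op A x (meet_op A y z)"
    and join_assoc: "\<lbrakk>x \<in> carrier A; y \<in> carrier A; z \<in> carrier A\<rbrakk>
          \<Longrightarrow> join_op A (join_op A x y) z = join_op A x (join_op A y z)"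
    and meet_absorb: "\<lbrakk>x \<in> carrier A; y \<in> carrier A\<rbrakk> \<Longrightarrow> meet_op A x (join_op A x y) = x"
    and join_absorb: "\<lbrakk>x \<in> carrier A; y \<in> carrier A\<rbrakk> \<Longrightarrow> join_op A x (meet_op A x y) = x"
    and mult_left_mono: "\<lbrakk>x \<in> carrier A; y \<in> carrier A; z \<in> carrier A; leq A x y\<rbrakk>
          \<Longrightarrow> leq A (z \<otimes> x) (z \<otimes> y)"
    and mult_right_mono: "\<lbrakk>x \<in> carrier A; y \<in> carrier A; z \<in> carrier A; leq A x y\<rbrakk>
          \<Longrightarrow> leq A (x \<otimes> z) (y \<otimes> z)"
    and linv_mult_le: "x \<in> carrier A \<Longrightarrow> leq A (linv A x \<otimes> x) \<one>"
    and le_mult_linv: "x \<in> carrier A \<Longrightarrow> leq A \<one> (x \<otimes> linv A x)"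
    and mult_rinv_le: "x \<in> carrier A \<Longrightarrow> leq A (x \<otimes> rinv A x) \<one>"
    and le_rinv_mult: "x \<in> carrier A \<Longrightarrow> leq A \<one> (rinv A x \<otimes> x)"

definition periodic :: "nat \<Rightarrow> ('a, 'm) lpregroup_scheme \<Rightarrow> bool" where
  "periodic n A \<longleftrightarrow> (\<forall>x \<in> carrier A. (linv A ^^ n) x = (rinv A ^^ n) x)"

definition lpregroup_embedding ::
  "('a \<Rightarrow> 'b) \<Rightarrow> ('a, 'm) lpregroup_scheme \<Rightarrow> ('b, 'k) lpregroup_scheme \<Rightarrow> bool" where
  "lpregroup_embedding h A B \<longleftrightarrow>
     h \<in> mon A B \<and> h \<one>\<^bsub>A\<^esub> = \<one>\<^bsub>B\<^esub> \<and>
     (\<forall>x \<in> carrier A. \<forall>y \<in> carrier A. h (meet_op A x y) = meet_op B (h x) (h y)) \<and>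
     (\<forall>x \<in> carrier A. \<forall>y \<in> carrier A. h (join_op A x y) = join_op B (h x) (h y)) \<and>
     (\<forall>x \<in> carrier A. h (linv A x) = linv B (h x)) \<and>
     (\<forall>x \<in> carrier A. h (rinv A x) = rinv B (h x))"

section \<open>The \<open>\<ell>\<close>-pregroup of maps on a chain\<close>

text \<open>A chain is given by a reflexive linear order relation \<open>\<Omega>\<close>, with \<open>Field \<Omega>\<close> as its set of
  points. Maps on the chain are extensional functions, so that equality of functions is equality
  of maps.\<close>

definition residual_pair :: "'p rel \<Rightarrow> ('p \<Rightarrow> 'p) \<Rightarrow> ('p \<Rightarrow> 'p) \<Rightarrow> bool" where
  "residual_pair \<Omega> f g \<longleftrightarrow>
     f \<in> Field \<Omega> \<rightarrow>\<^sub>E Field \<Omega> \<and> g \<in> Field \<Omega> \<rightarrow>\<^sub>E Field \<Omega> \<and>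
     (\<forall>a \<in> Field \<Omega>. \<forall>b \<in> Field \<Omega>. (f a, b) \<in> \<Omega> \<longleftrightarrow> (a, g b) \<in> \<Omega>)"

definition has_residual :: "'p rel \<Rightarrow> ('p \<Rightarrow> 'p) \<Rightarrow> bool" where
  "has_residual \<Omega> f \<longleftrightarrow> (\<exists>g. residual_pair \<Omega> f g)"

definition has_dual_residual :: "'p rel \<Rightarrow> ('p \<Rightarrow> 'p) \<Rightarrow> bool" where
  "has_dual_residual \<Omega> f \<longleftrightarrow> (\<exists>g. residual_pair \<Omega> g f)"

definition max_in :: "'p rel \<Rightarrow> 'p set \<Rightarrow> 'p" where
  "max_in \<Omega> S = (THE m. m \<in> S \<and> (\<forall>x \<in> S. (x, m) \<in> \<Omega>))"

definition min_in :: "'p rel \<Rightarrow> 'p set \<Rightarrow> 'p" where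
  "min_in \<Omega> S = (THE m. m \<in> S \<and> (\<forall>x \<in> S. (m, x) \<in> \<Omega>))"

text \<open>These two are meaningful only if the (dual) residual exists.\<close>

definition residual :: "'p rel \<Rightarrow> ('p \<Rightarrow> 'p) \<Rightarrow> ('p \<Rightarrow> 'p)" where
  "residual \<Omega> f = (\<lambda>b \<in> Field \<Omega>. max_in \<Omega> {a \<in> Field \<Omega>. (f a, b) \<in> \<Omega>})"

definition dual_residual :: "'p rel \<Rightarrow> ('p \<Rightarrow> 'p) \<Rightarrow> ('p \<Rightarrow> 'p)" where
  "dual_residual \<Omega> f = (\<lambda>a \<in> Field \<Omega>. min_in \<Omega> {b \<in> Field \<Omega>. (a, f b) \<in> \<Omega>})"

text \<open>Mixed iterates need no separate mention: the dual residual of a residual is the map itself,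
  and vice versa.\<close>

definition F_chain :: "'p rel \<Rightarrow> ('p \<Rightarrow> 'p) lpregroup" where
  "F_chain \<Omega> = \<lparr>
     carrier = {f \<in> Field \<Omega> \<rightarrow>\<^sub>E Field \<Omega>.
       \<forall>k. has_residual \<Omega> ((residual \<Omega> ^^ k) f) \<and>
           has_dual_residual \<Omega> ((dual_residual \<Omega> ^^ k) f)},
     mult = (\<lambda>f g. compose (Field \<Omega>) f g),
     one = (\<lambda>x \<in> Field \<Omega>. x),
     meet_op = (\<lambda>f g. \<lambda>x \<in> Field \<Omega>. min_in \<Omega> {f x, g x}),
     join_op = (\<lambda>f g. \<lambda>x \<in> Field \<Omega>. max_in \<Omega> {f x, g x}),
     linv = dual_residual \<Omega>,
     rinv = residual \<Omega>\<rparr>"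

definition Fn_chain :: "nat \<Rightarrow> 'p rel \<Rightarrow> ('p \<Rightarrow> 'p) lpregroup" where
  "Fn_chain n \<Omega> = (F_chain \<Omega>)\<lparr>carrier :=
     {f \<in> carrier (F_chain \<Omega>). (dual_residual \<Omega> ^^ n) f = (residual \<Omega> ^^ n) f}\<rparr>"

section \<open>Integral chains: lexicographic products of a chain with the integers\<close>

definition lex_Z :: "'j rel \<Rightarrow> ('j \<times> int) rel" where
  "lex_Z J = {((i, a), (j, b)) | i a j b.
     (i, j) \<in> J \<and> i \<noteq> j \<or> i \<in> Field J \<and> i = j \<and> a \<le> b}"

text \<open>HOL cannot quantify existentially over types, so an existentially quantified chain must have
  its points in some fixed type. For an \<open>\<ell>\<close>-pregroup over \<open>'a\<close> we use the following type, into
  which every set of cardinality at most \<open>2^(2^max(\<aleph>\<^sub>0, |'a|))\<close> injects.\<close>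

type_synonym 'a chain_points = "'a list set set"

end

theory Submission
  imports Defs "HOL-Library.Nat_Bijection"
begin

text \<open>Distributivity: suppose \<open>a \<and> b \<le> c\<close> and \<open>b \<le> a \<or> c\<close>. Then \<open>b a\<^sup>l a \<le> c\<close>, and the two
  hypotheses are inherited by \<open>a\<^sup>l\<^sup>l\<close>, hence by all even iterates \<open>a\<^sub>k\<close> of \<open>l\<close> on \<open>a\<close>. By periodicity
  the join \<open>p\<close> of these finitely many elements is fixed by \<open>x \<mapsto> x\<^sup>l\<^sup>l\<close>, so it is invertible, and
  \<open>b = b p\<^sup>l p = \<Or> b p\<^sup>l a\<^sub>k \<le> \<Or> b a\<^sub>k\<^sup>l a\<^sub>k \<le> c\<close>.

  Representation: for a prime filter \<open>F\<close> the sets \<open>{z. z x \<in> F}\<close> form a chain, on which the algebra acts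
  by residuated maps, and prime filters separate points. By periodicity such an orbit is either discrete
  (every point has an upper and a lower cover) or all maps on it are injective. In the second case every
  point can be replaced by a copy of the integers on which the maps act trivially; the ordered sum of the
  resulting chains is discrete, hence integral.\<close>

text \<open>The pattern is Holland's embedding of \<ell>-groups, the case \<open>n = 1\<close>, into
  the automorphisms of a chain. Distributivity has to be derived first because prime filters
  separate points only through it. Inclusion compares the filters of one orbit thanks to \<open>z
  \<otimes> x \<curlywedge> w \<otimes> y \<preceq> z \<otimes> y \<curlyvee> w \<otimes> x\<close>,
  but not those of different orbits, so the orbits are laid side by side in an arbitrary linear
  order. The obstacle is integrality: every point of the chain needs a cover on both sides. Copies
  of the integers create covers, but they destroy monotonicity if a map identifies two points
  \<open>S\<close> below \<open>T\<close>: the pair \<open>(S, 1)\<close> below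
  \<open>(T, 0)\<close> would be sent to a strictly decreasing one. Hence the dichotomy. If
  \<open>x\<close> is not injective, some \<open>p\<close> is not the top of its fibre under
  \<open>x\<close>; then \<open>(x\<^sup>r)\<^sup>r\<close> sends \<open>p\<close> to a point
  covered by the image of \<open>p\<close> under \<open>x\<close>, and a single cover spreads over
  the whole orbit. The spreading is where periodicity enters a second time.\<close>

section \<open>Arithmetic of \<open>\<ell>\<close>-pregroups\<close>

context lpregroup
begin

abbreviation le (infix "\<preceq>" 50) where "x \<preceq> y \<equiv> leq A x y"
abbreviation inf_A (infixl "\<curlywedge>" 68) where "x \<curlywedge> y \<equiv> meet_op A x y"
abbreviation sup_A (infixl "\<curlyvee>" 65) where "x \<curlyvee> y \<equiv> join_op A x y"
abbreviation linv_A ("_\<^sup>l" [1000] 999) where "x\<^sup>l \<equiv> linv A x"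
abbreviation rinv_A ("_\<^sup>r" [1000] 999) where "x\<^sup>r \<equiv> rinv A x"

declare meet_closed [simp] join_closed [simp] linv_closed [simp] rinv_closed [simp]

lemma meet_idem: "x \<in> carrier A \<Longrightarrow> x \<curlywedge> x = x"
  by (metis join_absorb meet_absorb meet_closed)

lemma le_refl [simp]: "x \<in> carrier A \<Longrightarrow> x \<preceq> x"
  by (simp add: leq_def meet_idem)

lemma le_antisym: "\<lbrakk>x \<preceq> y; y \<preceq> x; x \<in> carrier A; y \<in> carrier A\<rbrakk> \<Longrightarrow> x = y"
  by (metis leq_def meet_comm)

lemma le_trans: "\<lbrakk>x \<preceq> y; y \<preceq> z; x \<in> carrier A; y \<in> carrier A; z \<in> carrier A\<rbrakk> \<Longrightarrow> x \<preceq> z"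
  by (metis leq_def meet_assoc)

lemma meet_le1: "\<lbrakk>x \<in> carrier A; y \<in> carrier A\<rbrakk> \<Longrightarrow> x \<curlywedge> y \<preceq> x"
  by (metis leq_def meet_assoc meet_closed meet_comm meet_idem)

lemma meet_le2: "\<lbrakk>x \<in> carrier A; y \<in> carrier A\<rbrakk> \<Longrightarrow> x \<curlywedge> y \<preceq> y"
  by (metis meet_le1 meet_comm)

lemma le_meet: "\<lbrakk>z \<preceq> x; z \<preceq> y; x \<in> carrier A; y \<in> carrier A; z \<in> carrier A\<rbrakk> \<Longrightarrow> z \<preceq> x \<curlywedge> y"
  by (metis leq_def meet_assoc)

lemma le_iff_join: "\<lbrakk>x \<in> carrier A; y \<in> carrier A\<rbrakk> \<Longrightarrow> x \<preceq> y \<longleftrightarrow> x \<curlyvee> y = y"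
  by (metis leq_def join_absorb join_comm meet_absorb meet_comm)

lemma join_ge1: "\<lbrakk>x \<in> carrier A; y \<in> carrier A\<rbrakk> \<Longrightarrow> x \<preceq> x \<curlyvee> y"
  by (simp add: leq_def meet_absorb)

lemma join_ge2: "\<lbrakk>x \<in> carrier A; y \<in> carrier A\<rbrakk> \<Longrightarrow> y \<preceq> x \<curlyvee> y"
  by (metis join_ge1 join_comm)

lemma join_le: "\<lbrakk>x \<preceq> z; y \<preceq> z; x \<in> carrier A; y \<in> carrier A; z \<in> carrier A\<rbrakk> \<Longrightarrow> x \<curlyvee> y \<preceq> z"
  by (metis le_iff_join join_assoc join_closed)

section \<open>Residuation, and the two inversions as mutually inverse maps\<close>

lemma mult_le_iff_rinv:
  assumes "x \<in> carrier A" "y \<in> carrier A" "z \<in> carrier A"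
  shows "x \<otimes> y \<preceq> z \<longleftrightarrow> y \<preceq> x\<^sup>r \<otimes> z"
proof
  assume "x \<otimes> y \<preceq> z"
  then have "x\<^sup>r \<otimes> (x \<otimes> y) \<preceq> x\<^sup>r \<otimes> z" using assms by (intro mult_left_mono) auto
  moreover have "y \<preceq> x\<^sup>r \<otimes> (x \<otimes> y)"
    using mult_right_mono[OF _ _ _ le_rinv_mult, of x y] assms by (simp add: m_assoc)
  ultimately show "y \<preceq> x\<^sup>r \<otimes> z" using assms le_trans by (meson m_closed rinv_closed)
next
  assume "y \<preceq> x\<^sup>r \<otimes> z"
  then have "x \<otimes> y \<preceq> x \<otimes> (x\<^sup>r \<otimes> z)" using assms by (intro mult_left_mono) auto
  moreover have "x \<otimes> (x\<^sup>r \<otimes> z) \<preceq> z"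
    using mult_right_mono[OF _ _ _ mult_rinv_le, of x z] assms by (simp add: m_assoc)
  ultimately show "x \<otimes> y \<preceq> z" using assms le_trans by (meson m_closed rinv_closed)
qed

lemma mult_le_iff_linv:
  assumes "x \<in> carrier A" "y \<in> carrier A" "z \<in> carrier A"
  shows "x \<otimes> y \<preceq> z \<longleftrightarrow> x \<preceq> z \<otimes> y\<^sup>l"
proof
  assume "x \<otimes> y \<preceq> z"
  then have "x \<otimes> y \<otimes> y\<^sup>l \<preceq> z \<otimes> y\<^sup>l" using assms by (intro mult_right_mono) auto
  moreover have "x \<preceq> x \<otimes> y \<otimes> y\<^sup>l"
    using mult_left_mono[OF _ _ _ le_mult_linv, of y x] assms by (simp add: m_assoc)
  ultimately show "x \<preceq> z \<otimes> y\<^sup>l" using assms le_trans by (meson m_closed linv_closed)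
next
  assume "x \<preceq> z \<otimes> y\<^sup>l"
  then have "x \<otimes> y \<preceq> z \<otimes> y\<^sup>l \<otimes> y" using assms by (intro mult_right_mono) auto
  moreover have "z \<otimes> y\<^sup>l \<otimes> y \<preceq> z"
    using mult_left_mono[OF _ _ _ linv_mult_le, of y z] assms by (simp add: m_assoc)
  ultimately show "x \<otimes> y \<preceq> z" using assms le_trans by (meson m_closed linv_closed)
qed

lemma linv_unique:
  assumes "u \<in> carrier A" "x \<in> carrier A" "u \<otimes> x \<preceq> \<one>" "\<one> \<preceq> x \<otimes> u"
  shows "x\<^sup>l = u"
proof (rule le_antisym)
  have "x\<^sup>l \<otimes> \<one> \<preceq> x\<^sup>l \<otimes> (x \<otimes> u)" using assms by (intro mult_left_mono) auto
  also have "x\<^sup>l \<otimes> (x \<otimes> u) = (x\<^sup>l \<otimes> x) \<otimes> u" using assms by (simp add: m_assoc)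
  finally have "x\<^sup>l \<preceq> (x\<^sup>l \<otimes> x) \<otimes> u" using assms by simp
  moreover have "(x\<^sup>l \<otimes> x) \<otimes> u \<preceq> \<one> \<otimes> u" using assms linv_mult_le by (intro mult_right_mono) auto
  ultimately show "x\<^sup>l \<preceq> u" using assms le_trans by (metis m_closed l_one linv_closed)
  show "u \<preceq> x\<^sup>l" using mult_le_iff_linv[of u x \<one>] assms by simp
qed (use assms in auto)

lemma linv_rinv [simp]: "x \<in> carrier A \<Longrightarrow> (x\<^sup>r)\<^sup>l = x"
  by (simp add: linv_unique le_rinv_mult mult_rinv_le)

lemma linv_inj: "\<lbrakk>x\<^sup>l = y\<^sup>l; x \<in> carrier A; y \<in> carrier A\<rbrakk> \<Longrightarrow> x = y"
proof (rule le_antisym)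
  assume a: "x\<^sup>l = y\<^sup>l" "x \<in> carrier A" "y \<in> carrier A"
  show "x \<preceq> y" using mult_le_iff_linv[of \<one> x y] a le_mult_linv[of y] by simp
  show "y \<preceq> x" using mult_le_iff_linv[of \<one> y x] a le_mult_linv[of x] by simp
qed

lemma rinv_linv [simp]: "x \<in> carrier A \<Longrightarrow> (x\<^sup>l)\<^sup>r = x"
  by (rule linv_inj) auto

lemma linv_mult_le_iff:
  assumes "x \<in> carrier A" "y \<in> carrier A" "z \<in> carrier A"
  shows "x\<^sup>l \<otimes> y \<preceq> z \<longleftrightarrow> y \<preceq> x \<otimes> z"
  using mult_le_iff_rinv[of "x\<^sup>l" y z] assms by simp

lemma mult_rinv_le_iff:
  assumes "x \<in> carrier A" "y \<in> carrier A" "z \<in> carrier A"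
  shows "x \<otimes> y\<^sup>r \<preceq> z \<longleftrightarrow> x \<preceq> z \<otimes> y"
  using mult_le_iff_linv[of x "y\<^sup>r" z] assms by simp

lemma linv_one: "\<one>\<^sup>l = \<one>" by (rule linv_unique) auto

lemma linv_mult:
  assumes "x \<in> carrier A" "y \<in> carrier A"
  shows "(x \<otimes> y)\<^sup>l = y\<^sup>l \<otimes> x\<^sup>l"
proof (rule linv_unique)
  have "x\<^sup>l \<otimes> (x \<otimes> y) \<preceq> y" using assms by (subst linv_mult_le_iff) auto
  then have "x\<^sup>l \<otimes> (x \<otimes> y) \<preceq> y \<otimes> \<one>" using assms by simp
  then have "y\<^sup>l \<otimes> (x\<^sup>l \<otimes> (x \<otimes> y)) \<preceq> \<one>"  using assms by (subst linv_mult_le_iff) auto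
  then show "y\<^sup>l \<otimes> x\<^sup>l \<otimes> (x \<otimes> y) \<preceq> \<one>" using assms by (simp add: m_assoc)
  have "x \<preceq> x \<otimes> y \<otimes> y\<^sup>l" using assms by (subst mult_le_iff_linv[symmetric]) auto
  then have "\<one> \<otimes> x \<preceq> x \<otimes> y \<otimes> y\<^sup>l" using assms by simp
  then have "\<one> \<preceq> x \<otimes> y \<otimes> y\<^sup>l \<otimes> x\<^sup>l"  using assms by (subst mult_le_iff_linv[symmetric]) auto
  then show "\<one> \<preceq> x \<otimes> y \<otimes> (y\<^sup>l \<otimes> x\<^sup>l)" using assms by (simp add: m_assoc)
qed (use assms in auto)

lemma linv_antimono_iff:
  assumes "x \<in> carrier A" "y \<in> carrier A"
  shows "y\<^sup>l \<preceq> x\<^sup>l \<longleftrightarrow> x \<preceq> y"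
proof -
  have "y\<^sup>l \<preceq> x\<^sup>l \<longleftrightarrow> y\<^sup>l \<otimes> x \<preceq> \<one>" using assms mult_le_iff_linv[of "y\<^sup>l" x \<one>] by simp
  also have "\<dots> \<longleftrightarrow> x \<preceq> y" using assms linv_mult_le_iff[of y x \<one>] by simp
  finally show ?thesis .
qed

section \<open>Interaction of inversion and multiplication with the lattice operations\<close>

lemma linv_join:
  assumes "x \<in> carrier A" "y \<in> carrier A"
  shows "(x \<curlyvee> y)\<^sup>l = x\<^sup>l \<curlywedge> y\<^sup>l"
proof (rule le_antisym)
  show "(x \<curlyvee> y)\<^sup>l \<preceq> x\<^sup>l \<curlywedge> y\<^sup>l"
    using assms by (intro le_meet) (auto simp: linv_antimono_iff join_ge1 join_ge2)
  have "x \<preceq> (x\<^sup>l \<curlywedge> y\<^sup>l)\<^sup>r" "y \<preceq> (x\<^sup>l \<curlywedge> y\<^sup>l)\<^sup>r"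
    using assms linv_antimono_iff[of x "(x\<^sup>l \<curlywedge> y\<^sup>l)\<^sup>r"] linv_antimono_iff[of y "(x\<^sup>l \<curlywedge> y\<^sup>l)\<^sup>r"]
    by (auto simp: meet_le1 meet_le2)
  then have "x \<curlyvee> y \<preceq> (x\<^sup>l \<curlywedge> y\<^sup>l)\<^sup>r" using assms by (intro join_le) auto
  then show "x\<^sup>l \<curlywedge> y\<^sup>l \<preceq> (x \<curlyvee> y)\<^sup>l"
    using assms linv_antimono_iff[of "x \<curlyvee> y" "(x\<^sup>l \<curlywedge> y\<^sup>l)\<^sup>r"] by simp
qed (use assms in auto)

lemma linv_meet:
  assumes "x \<in> carrier A" "y \<in> carrier A"
  shows "(x \<curlywedge> y)\<^sup>l = x\<^sup>l \<curlyvee> y\<^sup>l"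
proof (rule le_antisym)
  show "x\<^sup>l \<curlyvee> y\<^sup>l \<preceq> (x \<curlywedge> y)\<^sup>l"
    using assms by (intro join_le) (auto simp: linv_antimono_iff meet_le1 meet_le2)
  have "(x\<^sup>l \<curlyvee> y\<^sup>l)\<^sup>r \<preceq> x" "(x\<^sup>l \<curlyvee> y\<^sup>l)\<^sup>r \<preceq> y"
    using assms linv_antimono_iff[of "(x\<^sup>l \<curlyvee> y\<^sup>l)\<^sup>r" x] linv_antimono_iff[of "(x\<^sup>l \<curlyvee> y\<^sup>l)\<^sup>r" y]
    by (auto simp: join_ge1 join_ge2)
  then have "(x\<^sup>l \<curlyvee> y\<^sup>l)\<^sup>r \<preceq> x \<curlywedge> y" using assms by (intro le_meet) auto
  then show "(x \<curlywedge> y)\<^sup>l \<preceq> x\<^sup>l \<curlyvee> y\<^sup>l"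
    using assms linv_antimono_iff[of "(x\<^sup>l \<curlyvee> y\<^sup>l)\<^sup>r" "x \<curlywedge> y"] by simp
qed (use assms in auto)

lemma mult_join_left:
  assumes "x \<in> carrier A" "y \<in> carrier A" "z \<in> carrier A"
  shows "z \<otimes> (x \<curlyvee> y) = z \<otimes> x \<curlyvee> z \<otimes> y"
proof (rule le_antisym)
  show "z \<otimes> x \<curlyvee> z \<otimes> y \<preceq> z \<otimes> (x \<curlyvee> y)"
    using assms by (intro join_le mult_left_mono) (auto simp: join_ge1 join_ge2)
  have "x \<curlyvee> y \<preceq> z\<^sup>r \<otimes> (z \<otimes> x \<curlyvee> z \<otimes> y)"
    using assms by (intro join_le) (simp_all add: mult_le_iff_rinv[symmetric] join_ge1 join_ge2)
  then show "z \<otimes> (x \<curlyvee> y) \<preceq> z \<otimes> x \<curlyvee> z \<otimes> y"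
    using assms by (simp add: mult_le_iff_rinv)
qed (use assms in auto)

lemma mult_join_right:
  assumes "x \<in> carrier A" "y \<in> carrier A" "z \<in> carrier A"
  shows "(x \<curlyvee> y) \<otimes> z = x \<otimes> z \<curlyvee> y \<otimes> z"
proof (rule le_antisym)
  show "x \<otimes> z \<curlyvee> y \<otimes> z \<preceq> (x \<curlyvee> y) \<otimes> z"
    using assms by (intro join_le mult_right_mono) (auto simp: join_ge1 join_ge2)
  have "x \<curlyvee> y \<preceq> (x \<otimes> z \<curlyvee> y \<otimes> z) \<otimes> z\<^sup>l"
    using assms by (intro join_le) (simp_all add: mult_le_iff_linv[symmetric] join_ge1 join_ge2)
  then show "(x \<curlyvee> y) \<otimes> z \<preceq> x \<otimes> z \<curlyvee> y \<otimes> z"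
    using assms by (simp add: mult_le_iff_linv)
qed (use assms in auto)

lemma mult_meet_left:
  assumes "x \<in> carrier A" "y \<in> carrier A" "z \<in> carrier A"
  shows "z \<otimes> (x \<curlywedge> y) = z \<otimes> x \<curlywedge> z \<otimes> y"
proof (rule le_antisym)
  show "z \<otimes> (x \<curlywedge> y) \<preceq> z \<otimes> x \<curlywedge> z \<otimes> y"
    using assms by (intro le_meet mult_left_mono) (auto simp: meet_le1 meet_le2)
  have "z\<^sup>l \<otimes> (z \<otimes> x \<curlywedge> z \<otimes> y) \<preceq> x \<curlywedge> y"
    using assms by (intro le_meet) (simp_all add: linv_mult_le_iff meet_le1 meet_le2)
  then show "z \<otimes> x \<curlywedge> z \<otimes> y \<preceq> z \<otimes> (x \<curlywedge> y)"
    using assms by (simp add: linv_mult_le_iff)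
qed (use assms in auto)

lemma mult_meet_right:
  assumes "x \<in> carrier A" "y \<in> carrier A" "z \<in> carrier A"
  shows "(x \<curlywedge> y) \<otimes> z = x \<otimes> z \<curlywedge> y \<otimes> z"
proof (rule le_antisym)
  show "(x \<curlywedge> y) \<otimes> z \<preceq> x \<otimes> z \<curlywedge> y \<otimes> z"
    using assms by (intro le_meet mult_right_mono) (auto simp: meet_le1 meet_le2)
  have "(x \<otimes> z \<curlywedge> y \<otimes> z) \<otimes> z\<^sup>r \<preceq> x \<curlywedge> y"
    using assms by (intro le_meet) (simp_all add: mult_rinv_le_iff meet_le1 meet_le2)
  then show "x \<otimes> z \<curlywedge> y \<otimes> z \<preceq> (x \<curlywedge> y) \<otimes> z"
    using assms by (simp add: mult_rinv_le_iff)
qed (use assms in auto)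

text \<open>Since \<open>y\<^sup>l = y\<^sup>l \<otimes> \<one>\<close>, the meet lies below
  \<open>(y\<^sup>l \<curlywedge> \<one>) \<otimes> (y \<curlyvee> \<one>)\<close>, which is
  \<open>u\<^sup>l \<otimes> u\<close> for \<open>u = y \<curlyvee> \<one>\<close>. This closes the
  proof of \<open>cut_meet_le\<close>.\<close>

lemma linv_meet_join_one:
  assumes "y \<in> carrier A" shows "y\<^sup>l \<curlywedge> (y \<curlyvee> \<one>) \<preceq> \<one>"
proof -
  have "y\<^sup>l \<otimes> \<one> \<preceq> y\<^sup>l \<otimes> (y \<curlyvee> \<one>)" using assms by (intro mult_left_mono) (auto simp: join_ge2)
  then have "y\<^sup>l \<curlywedge> (y \<curlyvee> \<one>) \<preceq> y\<^sup>l \<otimes> (y \<curlyvee> \<one>) \<curlywedge> \<one> \<otimes> (y \<curlyvee> \<one>)"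
    using assms by (intro le_meet) (auto intro: le_trans[OF meet_le1] meet_le2)
  also have "\<dots> = (y \<curlyvee> \<one>)\<^sup>l \<otimes> (y \<curlyvee> \<one>)"
    using assms by (simp add: linv_join mult_meet_right linv_one)
  finally show ?thesis
    using assms linv_mult_le[of "y \<curlyvee> \<one>"] le_trans by (meson join_closed linv_closed m_closed meet_closed one_closed)
qed

text \<open>Order dual of \<open>linv_meet_join_one\<close>, now from
  \<open>\<one> \<preceq> u \<otimes> u\<^sup>l\<close> with
  \<open>u = \<one> \<curlywedge> y\<close>. This closes the proof of
  \<open>cut_le_join\<close>.\<close>

lemma one_le_linv_join_meet:
  assumes "y \<in> carrier A" shows "\<one> \<preceq> y\<^sup>l \<curlyvee> (\<one> \<curlywedge> y)"
proof -
  have "(\<one> \<curlywedge> y) \<otimes> y\<^sup>l \<preceq> \<one> \<otimes> y\<^sup>l" using assms by (intro mult_right_mono) (auto simp: meet_le1)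
  then have "(\<one> \<curlywedge> y) \<otimes> \<one> \<curlyvee> (\<one> \<curlywedge> y) \<otimes> y\<^sup>l \<preceq> y\<^sup>l \<curlyvee> (\<one> \<curlywedge> y)"
    using assms by (intro join_le) (auto intro: le_trans[OF _ join_ge1] join_ge2)
  moreover have "(\<one> \<curlywedge> y) \<otimes> \<one> \<curlyvee> (\<one> \<curlywedge> y) \<otimes> y\<^sup>l = (\<one> \<curlywedge> y) \<otimes> (\<one> \<curlywedge> y)\<^sup>l"
    using assms by (simp add: linv_meet mult_join_left linv_one)
  ultimately show ?thesis
    using assms le_mult_linv[of "\<one> \<curlywedge> y"] by (metis join_closed linv_closed m_closed meet_closed one_closed le_trans)
qed

text \<open>For \<open>u = z \<curlyvee> w\<close>, enlarging the right factors to \<open>u\<close>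
  gives \<open>w\<^sup>l \<otimes> u\<close> and \<open>z\<^sup>l \<otimes> u\<close>, whose meet is
  \<open>u\<^sup>l \<otimes> u\<close>. The inequality makes the translates of a prime filter
  comparable.\<close>

lemma linv_mult_meet_le_one:
  assumes "z \<in> carrier A" "w \<in> carrier A"
  shows "w\<^sup>l \<otimes> z \<curlywedge> z\<^sup>l \<otimes> w \<preceq> \<one>"
proof -
  have *: "w\<^sup>l \<otimes> z \<preceq> w\<^sup>l \<otimes> (z \<curlyvee> w)" "z\<^sup>l \<otimes> w \<preceq> z\<^sup>l \<otimes> (z \<curlyvee> w)"
    using assms by (auto intro!: mult_left_mono simp: join_ge1 join_ge2)
  have "w\<^sup>l \<otimes> z \<curlywedge> z\<^sup>l \<otimes> w \<preceq> z\<^sup>l \<otimes> (z \<curlyvee> w) \<curlywedge> w\<^sup>l \<otimes> (z \<curlyvee> w)"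
    using assms * by (intro le_meet) (auto intro: le_trans[OF meet_le1] le_trans[OF meet_le2])
  also have "\<dots> = (z \<curlyvee> w)\<^sup>l \<otimes> (z \<curlyvee> w)"
    using assms by (simp add: linv_join mult_meet_right)
  finally show ?thesis
    using assms linv_mult_le[of "z \<curlyvee> w"] le_trans by (meson join_closed linv_closed m_closed meet_closed one_closed)
qed

end

section \<open>Distributivity\<close>

context lpregroup
begin

text \<open>The premises of the sequent rule that infers \<open>b |- c\<close> from
  \<open>a, b |- c\<close> and \<open>b |- a, c\<close>. A lattice is distributive exactly if this
  rule is valid in it; \<open>cut_le\<close> proves the validity.\<close>

definition cut :: "'a \<Rightarrow> 'a \<Rightarrow> 'a \<Rightarrow> bool" where
  "cut a b c \<longleftrightarrow> a \<in> carrier A \<and> b \<in> carrier A \<and> c \<in> carrier A \<and> a \<curlywedge> b \<preceq> c \<and> b \<preceq> a \<curlyvee> c"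

lemma le_mult_linv_mult:
  assumes "a \<in> carrier A" "b \<in> carrier A" shows "b \<preceq> a \<otimes> (a\<^sup>l \<otimes> b)"
  using assms linv_mult_le_iff[of a b "a\<^sup>l \<otimes> b"] by simp

lemma mult_linv_mult_le:
  assumes "a \<in> carrier A" "b \<in> carrier A" shows "b \<otimes> a\<^sup>l \<otimes> a \<preceq> b"
  using assms mult_le_iff_linv[of "b \<otimes> a\<^sup>l" a b] by simp

text \<open>Moving \<open>c\<close> to the other side as \<open>c\<^sup>l\<close> turns the goal
  into a bound by \<open>\<one>\<close>, and \<open>?j\<^sup>l \<otimes> ?j\<close> provides it
  because \<open>?j\<^sup>l = a\<^sup>l \<curlywedge> c\<^sup>l\<close>. The half with
  \<open>a\<^sup>l\<close> takes both premises of the cut, the half with \<open>c\<^sup>l\<close>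
  takes \<open>b \<preceq> ?j\<close>.\<close>

lemma cut_mult_linv_le:
  assumes "cut a b c" shows "b \<otimes> a\<^sup>l \<otimes> a \<preceq> c"
proof -
  have [simp]: "a \<in> carrier A" "b \<in> carrier A" "c \<in> carrier A"
    and m: "a \<curlywedge> b \<preceq> c" and bj: "b \<preceq> a \<curlyvee> c"
    using assms by (auto simp: cut_def)
  let ?j = "a \<curlyvee> c" and ?d = "b \<otimes> a\<^sup>l \<otimes> a"
  have aj: "a \<preceq> ?j" by (simp add: join_ge1)
  have db: "?d \<preceq> b" by (simp add: mult_linv_mult_le)
  have "?d \<preceq> a \<otimes> (a\<^sup>l \<otimes> ?j)"
    using le_trans[OF le_trans[OF db bj] le_mult_linv_mult[of a ?j]] by simp
  moreover have "?d \<preceq> b \<otimes> (a\<^sup>l \<otimes> ?j)"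
    using mult_left_mono[OF _ _ _ aj, of "b \<otimes> a\<^sup>l"] by (simp add: m_assoc)
  ultimately have "?d \<preceq> (a \<curlywedge> b) \<otimes> (a\<^sup>l \<otimes> ?j)"
    by (simp add: mult_meet_right le_meet)
  then have "?d \<preceq> c \<otimes> (a\<^sup>l \<otimes> ?j)"
    by (rule le_trans) (auto intro!: mult_right_mono m)
  then have 1: "c\<^sup>l \<otimes> ?d \<preceq> a\<^sup>l \<otimes> ?j" by (subst linv_mult_le_iff) auto
  have 2: "c\<^sup>l \<otimes> ?d \<preceq> c\<^sup>l \<otimes> ?j"
    using le_trans[OF db bj] by (intro mult_left_mono) auto
  have "c\<^sup>l \<otimes> ?d \<preceq> ?j\<^sup>l \<otimes> ?j"
    using 1 2 by (simp add: linv_join mult_meet_right le_meet)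
  then have "c\<^sup>l \<otimes> ?d \<preceq> \<one>" by (rule le_trans) (simp_all add: linv_mult_le)
  then show ?thesis using linv_mult_le_iff[of c ?d \<one>] by simp
qed

text \<open>The choice \<open>?y = a\<^sup>l \<otimes> c\<close> is made for
  \<open>?y\<^sup>l = c\<^sup>l \<otimes> (a\<^sup>l)\<^sup>l\<close>, which bounds
  \<open>c\<^sup>l \<otimes> ?d\<close>. The premises give the second bound
  \<open>?y \<curlyvee> \<one>\<close>, and the two bounds meet below \<open>\<one>\<close>.\<close>

lemma cut_meet_le:
  assumes "cut a b c" shows "(a\<^sup>l)\<^sup>l \<curlywedge> b \<preceq> c"
proof -
  have [simp]: "a \<in> carrier A" "b \<in> carrier A" "c \<in> carrier A"
    and m: "a \<curlywedge> b \<preceq> c" and bj: "b \<preceq> a \<curlyvee> c"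
    using assms by (auto simp: cut_def)
  let ?y = "a\<^sup>l \<otimes> c" and ?d = "(a\<^sup>l)\<^sup>l \<curlywedge> b"
  have "a\<^sup>l \<otimes> b \<preceq> a\<^sup>l \<otimes> (a \<curlyvee> c)" by (intro mult_left_mono bj) simp_all
  also have "a\<^sup>l \<otimes> (a \<curlyvee> c) = a\<^sup>l \<otimes> a \<curlyvee> ?y" by (simp add: mult_join_left)
  finally have "a\<^sup>l \<otimes> b \<preceq> ?y \<curlyvee> \<one>"
    by (rule le_trans) (auto intro!: join_le intro: le_trans[OF linv_mult_le] simp: join_ge1 join_ge2)
  then have "b \<preceq> a \<otimes> (?y \<curlyvee> \<one>)" by (subst (asm) linv_mult_le_iff) auto
  moreover have "b \<preceq> b \<otimes> (?y \<curlyvee> \<one>)"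
    using mult_left_mono[of \<one> "?y \<curlyvee> \<one>" b] by (simp add: join_ge2)
  ultimately have "b \<preceq> (a \<curlywedge> b) \<otimes> (?y \<curlyvee> \<one>)" by (simp add: mult_meet_right le_meet)
  then have b: "b \<preceq> c \<otimes> (?y \<curlyvee> \<one>)"
    by (rule le_trans) (auto intro!: mult_right_mono m)
  have "?d \<preceq> c \<otimes> (?y \<curlyvee> \<one>)" by (rule le_trans[OF meet_le2 b]) auto
  then have 1: "c\<^sup>l \<otimes> ?d \<preceq> ?y \<curlyvee> \<one>" by (subst linv_mult_le_iff) auto
  have 2: "c\<^sup>l \<otimes> ?d \<preceq> ?y\<^sup>l"
    by (auto simp: linv_mult intro!: mult_left_mono meet_le1)
  have "c\<^sup>l \<otimes> ?d \<preceq> \<one>"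
    using 1 2 by (intro le_trans[OF le_meet linv_meet_join_one[of ?y]]) auto
  then show ?thesis using linv_mult_le_iff[of c ?d \<one>] by simp
qed

text \<open>Here \<open>?z = b \<otimes> a\<^sup>l\<close> is chosen for
  \<open>?z\<^sup>l = (a\<^sup>l)\<^sup>l \<otimes> b\<^sup>l\<close>. Left multiplication by
  \<open>\<one> \<curlywedge> ?z\<close> takes both \<open>a\<close> and \<open>c\<close> below
  \<open>c\<close>, hence also \<open>b\<close>; so \<open>?z\<^sup>l\<close> and
  \<open>\<one> \<curlywedge> ?z\<close> both lie below \<open>?d \<otimes> b\<^sup>l\<close>, and
  their join is above \<open>\<one>\<close>.\<close>

lemma cut_le_join:
  assumes "cut a b c" shows "b \<preceq> (a\<^sup>l)\<^sup>l \<curlyvee> c"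
proof -
  have [simp]: "a \<in> carrier A" "b \<in> carrier A" "c \<in> carrier A"
    and m: "a \<curlywedge> b \<preceq> c" and bj: "b \<preceq> a \<curlyvee> c"
    using assms by (auto simp: cut_def)
  let ?z = "b \<otimes> a\<^sup>l" and ?d = "(a\<^sup>l)\<^sup>l \<curlyvee> c"
  have "(a \<curlywedge> b) \<otimes> a\<^sup>l \<preceq> c \<otimes> a\<^sup>l" by (intro mult_right_mono m) simp_all
  moreover have "(a \<curlywedge> b) \<otimes> a\<^sup>l = a \<otimes> a\<^sup>l \<curlywedge> ?z" by (simp add: mult_meet_right)
  moreover have "\<one> \<curlywedge> ?z \<preceq> a \<otimes> a\<^sup>l \<curlywedge> ?z"
    by (auto intro!: le_meet intro: le_trans[OF meet_le1 le_mult_linv] simp: meet_le2)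
  ultimately have "\<one> \<curlywedge> ?z \<preceq> c \<otimes> a\<^sup>l"
    using le_trans[of "\<one> \<curlywedge> ?z" "a \<otimes> a\<^sup>l \<curlywedge> ?z" "c \<otimes> a\<^sup>l"] by simp
  then have "(\<one> \<curlywedge> ?z) \<otimes> a \<preceq> c" by (subst mult_le_iff_linv) auto
  moreover have "(\<one> \<curlywedge> ?z) \<otimes> c \<preceq> c"
    using mult_right_mono[of "\<one> \<curlywedge> ?z" \<one> c] by (simp add: meet_le1)
  ultimately have "(\<one> \<curlywedge> ?z) \<otimes> (a \<curlyvee> c) \<preceq> c" by (simp add: mult_join_left join_le)
  moreover have "(\<one> \<curlywedge> ?z) \<otimes> b \<preceq> (\<one> \<curlywedge> ?z) \<otimes> (a \<curlyvee> c)"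
    by (intro mult_left_mono bj) simp_all
  ultimately have c: "(\<one> \<curlywedge> ?z) \<otimes> b \<preceq> c"
    using le_trans[of "(\<one> \<curlywedge> ?z) \<otimes> b" "(\<one> \<curlywedge> ?z) \<otimes> (a \<curlyvee> c)" c] by simp
  have "(\<one> \<curlywedge> ?z) \<otimes> b \<preceq> ?d" by (rule le_trans[OF c join_ge2]) auto
  then have 1: "\<one> \<curlywedge> ?z \<preceq> ?d \<otimes> b\<^sup>l" by (subst (asm) mult_le_iff_linv) auto
  have 2: "?z\<^sup>l \<preceq> ?d \<otimes> b\<^sup>l"
    by (auto simp: linv_mult intro!: mult_right_mono join_ge1)
  have "\<one> \<preceq> ?d \<otimes> b\<^sup>l"
    using 1 2 by (intro le_trans[OF one_le_linv_join_meet[of ?z] join_le]) auto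
  then show ?thesis using mult_le_iff_linv[of \<one> b ?d] by simp
qed

lemma cut_linv_linv: "cut a b c \<Longrightarrow> cut ((a\<^sup>l)\<^sup>l) b c"
  using cut_meet_le cut_le_join by (simp add: cut_def)

section \<open>Iterated inversion and periodicity\<close>

lemma linv_funpow_closed [simp]: "x \<in> carrier A \<Longrightarrow> (linv A ^^ k) x \<in> carrier A"
  by (induction k) auto

lemma rinv_funpow_closed [simp]: "x \<in> carrier A \<Longrightarrow> (rinv A ^^ k) x \<in> carrier A"
  by (induction k) auto

lemma linv_funpow_rinv_funpow: "x \<in> carrier A \<Longrightarrow> (linv A ^^ k) ((rinv A ^^ k) x) = x"
proof (induction k arbitrary: x)
  case (Suc k)
  then show ?case by (simp add: funpow_swap1)
qed simp

lemma rinv_funpow_linv_funpow: "x \<in> carrier A \<Longrightarrow> (rinv A ^^ k) ((linv A ^^ k) x) = x"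
proof (induction k arbitrary: x)
  case (Suc k)
  then show ?case by (simp add: funpow_swap1)
qed simp

lemma periodic_linv:
  assumes "periodic n A" "x \<in> carrier A" shows "(linv A ^^ (2 * n)) x = x"
proof -
  have "(linv A ^^ n) x = (rinv A ^^ n) x" using assms by (simp add: periodic_def)
  then have "(linv A ^^ n) ((linv A ^^ n) x) = x" using assms by (simp add: linv_funpow_rinv_funpow)
  then show ?thesis by (simp add: mult_2 funpow_add)
qed

lemma periodic_rinv:
  assumes "periodic n A" "x \<in> carrier A" shows "(rinv A ^^ (2 * n)) x = x"
  by (metis assms periodic_linv rinv_funpow_linv_funpow)

end

locale periodic_lpregroup = lpregroup +
  fixes n :: nat
  assumes n_pos: "n \<ge> 1" and per: "periodic n A"
begin

text \<open>Even iterates only: \<open>linv\<close> reverses the order, its square is an order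
  automorphism.\<close>

abbreviation conj2 :: "'a \<Rightarrow> nat \<Rightarrow> 'a" where
  "conj2 a k \<equiv> (linv A ^^ (2 * k)) a"

lemma finite_join_exists:
  fixes f :: "nat \<Rightarrow> 'a"
  assumes "\<And>i. i \<le> k \<Longrightarrow> f i \<in> carrier A"
  shows "\<exists>p \<in> carrier A. (\<forall>i \<le> k. f i \<preceq> p) \<and> (\<forall>q \<in> carrier A. (\<forall>i \<le> k. f i \<preceq> q) \<longrightarrow> p \<preceq> q)"
  using assms
proof (induction k)
  case 0
  then show ?case by (intro bexI[of _ "f 0"]) auto
next
  case (Suc k)
  then obtain p where p: "p \<in> carrier A" "\<forall>i \<le> k. f i \<preceq> p"
    "\<And>q. q \<in> carrier A \<Longrightarrow> \<forall>i \<le> k. f i \<preceq> q \<Longrightarrow> p \<preceq> q" by auto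
  have "f (Suc k) \<in> carrier A" using Suc by auto
  then have "f i \<preceq> p \<curlyvee> f (Suc k)" if "i \<le> Suc k" for i
    using that p Suc.prems le_trans[of "f i" p "p \<curlyvee> f (Suc k)"]
    by (cases "i = Suc k") (auto simp: join_ge1 join_ge2)
  moreover have "p \<curlyvee> f (Suc k) \<preceq> q" if "q \<in> carrier A" "\<forall>i \<le> Suc k. f i \<preceq> q" for q
    using that p Suc.prems by (intro join_le) auto
  ultimately show ?case using p Suc.prems by (intro bexI[of _ "p \<curlyvee> f (Suc k)"]) auto
qed

lemma invertible_join:
  assumes a: "a \<in> carrier A"
  obtains p where "p \<in> carrier A" "p\<^sup>l \<otimes> p = \<one>" "\<And>k. conj2 a k \<preceq> p"
    "\<And>q. q \<in> carrier A \<Longrightarrow> (\<And>k. conj2 a k \<preceq> q) \<Longrightarrow> p \<preceq> q"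
proof -
  obtain p where p: "p \<in> carrier A" "\<forall>i \<le> n. conj2 a i \<preceq> p"
    "\<And>q. q \<in> carrier A \<Longrightarrow> \<forall>i \<le> n. conj2 a i \<preceq> q \<Longrightarrow> p \<preceq> q"
    using finite_join_exists[of n "conj2 a"] a by auto
  \<comment> \<open>The iterates of \<open>linv\<close> on \<open>a\<close> repeat after
    \<open>2 * n\<close> steps, so the join of finitely many of them bounds all.\<close>
  have mod: "conj2 a k = conj2 a (k mod n)" for k
  proof -
    have "conj2 x (n * j) = x" if "x \<in> carrier A" for x j
    proof (induction j)
      case (Suc j)
      have "2 * (n * Suc j) = 2 * n + 2 * (n * j)" by (simp add: algebra_simps)
      then show ?case using Suc that per by (simp add: funpow_add periodic_linv)
    qed simp
    from this[of "conj2 a (k mod n)" "k div n"] have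
      "conj2 (conj2 a (k mod n)) (n * (k div n)) = conj2 a (k mod n)" using a by simp
    moreover have "2 * k = 2 * (n * (k div n)) + 2 * (k mod n)"
      by (metis distrib_left mult_div_mod_eq)
    ultimately show ?thesis by (metis funpow_add comp_apply)
  qed
  have up: "conj2 a k \<preceq> p" for k
    using p(2) mod[of k] n_pos by (metis mod_less_divisor less_imp_le_nat less_eq_Suc_le One_nat_def)
  have lub: "p \<preceq> q" if "q \<in> carrier A" "\<And>k. conj2 a k \<preceq> q" for q
    using p(3) that by auto
  have S: "conj2 a (Suc k) = ((conj2 a k)\<^sup>l)\<^sup>l" for k by simp
  have "p \<preceq> (p\<^sup>l)\<^sup>l"
  proof (rule lub)
    fix k
    \<comment> \<open>Adding the period makes the index positive, so that a predecessor exists for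
      \<open>k = 0\<close> as well.\<close>
    have "conj2 a k = conj2 a (k + n)" using mod[of k] mod[of "k + n"] by simp
    also have "\<dots> = ((conj2 a (k + n - 1))\<^sup>l)\<^sup>l" using S[of "k + n - 1"] n_pos by simp
    also have "\<dots> \<preceq> (p\<^sup>l)\<^sup>l" using a p up by (simp add: linv_antimono_iff)
    finally show "conj2 a k \<preceq> (p\<^sup>l)\<^sup>l" .
  qed (use p in simp)
  moreover have "(p\<^sup>l)\<^sup>l \<preceq> p"
  proof -
    \<comment> \<open>Leastness bounds \<open>p\<close> from above only, hence the detour through
      the inverse automorphism.\<close>
    have "p \<preceq> (p\<^sup>r)\<^sup>r"
    proof (rule lub)
      fix k
      have "((conj2 a k)\<^sup>l)\<^sup>l \<preceq> p" using up[of "Suc k"] by simp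
      then have "((conj2 a k)\<^sup>l)\<^sup>l \<preceq> (((p\<^sup>r)\<^sup>r)\<^sup>l)\<^sup>l" using p by simp
      then show "conj2 a k \<preceq> (p\<^sup>r)\<^sup>r" using a p by (simp del: linv_rinv add: linv_antimono_iff)
    qed (use p in simp)
    then have "(p\<^sup>l)\<^sup>l \<preceq> (((p\<^sup>r)\<^sup>r)\<^sup>l)\<^sup>l" using p by (simp del: linv_rinv add: linv_antimono_iff)
    then show ?thesis using p by simp
  qed
  ultimately have "(p\<^sup>l)\<^sup>l = p" using p by (simp add: le_antisym)
  then have "p\<^sup>l = p\<^sup>r" by (metis linv_closed p(1) rinv_linv)
  \<comment> \<open>Once \<open>p\<^sup>l = p\<^sup>r\<close>, the axioms
    \<open>p\<^sup>l \<otimes> p \<preceq> \<one>\<close> and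
    \<open>\<one> \<preceq> p\<^sup>r \<otimes> p\<close> speak of the same product.\<close>
  then have "p\<^sup>l \<otimes> p = \<one>"
    using p le_rinv_mult[of p] linv_mult_le[of p] by (auto intro: le_antisym)
  with that p up lub show thesis by blast
qed

lemma cut_le:
  assumes "cut a b c" shows "b \<preceq> c"
proof -
  have [simp]: "a \<in> carrier A" "b \<in> carrier A" "c \<in> carrier A"
    using assms by (auto simp: cut_def)
  have cut: "cut (conj2 a k) b c" for k
    using assms by (induction k) (auto intro: cut_linv_linv)
  obtain p where p [simp]: "p \<in> carrier A" and "p\<^sup>l \<otimes> p = \<one>" and up: "\<And>k. conj2 a k \<preceq> p"
    and lub: "\<And>q. q \<in> carrier A \<Longrightarrow> (\<And>k. conj2 a k \<preceq> q) \<Longrightarrow> p \<preceq> q"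
    using invertible_join[of a] by auto
  \<comment> \<open>Residuation replaces distributing \<open>b \<otimes> p\<^sup>l\<close> over a
    finite join: the set of \<open>x\<close> with
    \<open>b \<otimes> p\<^sup>l \<otimes> x \<preceq> c\<close> has a greatest element, and
    leastness of \<open>p\<close> applies to it.\<close>
  have "p \<preceq> (b \<otimes> p\<^sup>l)\<^sup>r \<otimes> c"
  proof (rule lub)
    fix k
    have "b \<otimes> p\<^sup>l \<otimes> conj2 a k \<preceq> b \<otimes> (conj2 a k)\<^sup>l \<otimes> conj2 a k"
      using up[of k] by (auto intro!: mult_right_mono mult_left_mono simp: linv_antimono_iff)
    then have "b \<otimes> p\<^sup>l \<otimes> conj2 a k \<preceq> c"
      using cut_mult_linv_le[OF cut] by (rule le_trans) auto
    then show "conj2 a k \<preceq> (b \<otimes> p\<^sup>l)\<^sup>r \<otimes> c" by (simp add: mult_le_iff_rinv)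
  qed simp
  then have "b \<otimes> p\<^sup>l \<otimes> p \<preceq> c" by (simp add: mult_le_iff_rinv)
  then show ?thesis using \<open>p\<^sup>l \<otimes> p = \<one>\<close> by (simp add: m_assoc)
qed

end

section \<open>Prime filters\<close>

context lpregroup
begin

text \<open>The empty set and the whole carrier qualify, also as prime filters. Each equals all its
  translates; its one-point orbit has no covers and so falls under the injective case later
  on.\<close>

definition lattice_filter :: "'a set \<Rightarrow> bool" where
  "lattice_filter F \<longleftrightarrow> F \<subseteq> carrier A \<and> (\<forall>x \<in> F. \<forall>y \<in> F. x \<curlywedge> y \<in> F) \<and>
     (\<forall>x \<in> F. \<forall>y \<in> carrier A. x \<preceq> y \<longrightarrow> y \<in> F)"

definition prime_filter :: "'a set \<Rightarrow> bool" where
  "prime_filter F \<longleftrightarrow> lattice_filter F \<and>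
     (\<forall>x \<in> carrier A. \<forall>y \<in> carrier A. x \<curlyvee> y \<in> F \<longrightarrow> x \<in> F \<or> y \<in> F)"

lemma lattice_filter_meet_iff:
  assumes "lattice_filter F" "x \<in> carrier A" "y \<in> carrier A"
  shows "x \<curlywedge> y \<in> F \<longleftrightarrow> x \<in> F \<and> y \<in> F"
  using assms meet_le1[of x y] meet_le2[of x y] meet_closed[of x y] unfolding lattice_filter_def by metis

lemma prime_filter_join_iff:
  assumes "prime_filter F" "x \<in> carrier A" "y \<in> carrier A"
  shows "x \<curlyvee> y \<in> F \<longleftrightarrow> x \<in> F \<or> y \<in> F"
  using assms join_ge1[of x y] join_ge2[of x y] join_closed[of x y]
  unfolding prime_filter_def lattice_filter_def by metis

text \<open>Multiplying on the right of \<open>z\<close> makes this a left action, in agreement with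
  composition of maps.\<close>

definition translate :: "'a \<Rightarrow> 'a set \<Rightarrow> 'a set" where
  "translate x S = {z \<in> carrier A. z \<otimes> x \<in> S}"

lemma translate_mult:
  "\<lbrakk>x \<in> carrier A; y \<in> carrier A\<rbrakk> \<Longrightarrow> translate (x \<otimes> y) S = translate x (translate y S)"
  by (auto simp: translate_def m_assoc)

lemma translate_one: "S \<subseteq> carrier A \<Longrightarrow> translate \<one> S = S"
  by (auto simp: translate_def)

lemma translate_mono: "S \<subseteq> T \<Longrightarrow> translate x S \<subseteq> translate x T"
  by (auto simp: translate_def)

lemma prime_filter_translate:
  assumes F: "prime_filter F" and x: "x \<in> carrier A"
  shows "prime_filter (translate x F)"
proof -
  have "lattice_filter F" using F by (simp add: prime_filter_def)
  have "lattice_filter (translate x F)"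
    unfolding lattice_filter_def
  proof (intro conjI ballI impI)
    show "translate x F \<subseteq> carrier A" by (auto simp: translate_def)
  next
    fix y z assume "y \<in> translate x F" "z \<in> translate x F"
    then show "y \<curlywedge> z \<in> translate x F"
      using \<open>lattice_filter F\<close> x by (simp add: translate_def mult_meet_right lattice_filter_meet_iff)
  next
    fix y z assume "y \<in> translate x F" "z \<in> carrier A" "y \<preceq> z"
    then show "z \<in> translate x F"
      using \<open>lattice_filter F\<close> x mult_right_mono[of y z x] by (auto simp: translate_def lattice_filter_def)
  qed
  then show ?thesis
    using F x by (simp add: prime_filter_def translate_def mult_join_right)
qed

lemma translate_le:
  assumes F: "prime_filter F" and xy: "x \<in> carrier A" "y \<in> carrier A" "x \<preceq> y"
  shows "translate x F \<subseteq> translate y F"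
  using assms mult_left_mono[of x y] unfolding translate_def prime_filter_def lattice_filter_def by auto

lemma translate_meet:
  assumes "prime_filter F" "x \<in> carrier A" "y \<in> carrier A"
  shows "translate (x \<curlywedge> y) F = translate x F \<inter> translate y F"
  using assms by (auto simp: translate_def mult_meet_left lattice_filter_meet_iff prime_filter_def)

lemma translate_join:
  assumes "prime_filter F" "x \<in> carrier A" "y \<in> carrier A"
  shows "translate (x \<curlyvee> y) F = translate x F \<union> translate y F"
  using assms by (auto simp: translate_def mult_join_left prime_filter_join_iff)

text \<open>Factor each of \<open>x\<close>, \<open>y\<close> through the other:
  \<open>x \<preceq> y \<otimes> (y\<^sup>l \<otimes> x)\<close> and
  \<open>y \<preceq> x \<otimes> (x\<^sup>l \<otimes> y)\<close>. Both products on the left then lie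
  below a multiple of \<open>?t\<close>, and the two multipliers meet below \<open>\<one>\<close>.
  In a prime filter this forbids that \<open>z\<close> and \<open>w\<close> separate the translates
  by \<open>x\<close> and \<open>y\<close> in opposite directions.\<close>

lemma cross_meet_le_join:
  assumes [simp]: "x \<in> carrier A" "y \<in> carrier A" "z \<in> carrier A" "w \<in> carrier A"
  shows "z \<otimes> x \<curlywedge> w \<otimes> y \<preceq> z \<otimes> y \<curlyvee> w \<otimes> x"
proof -
  let ?t = "z \<otimes> y \<curlyvee> w \<otimes> x"
  have "z \<otimes> x \<preceq> z \<otimes> (y \<otimes> (y\<^sup>l \<otimes> x))" by (intro mult_left_mono le_mult_linv_mult) auto
  also have "\<dots> = z \<otimes> y \<otimes> (y\<^sup>l \<otimes> x)" by (simp add: m_assoc)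
  finally have "z \<otimes> x \<preceq> ?t \<otimes> (y\<^sup>l \<otimes> x)"
    by (rule le_trans) (auto intro!: mult_right_mono join_ge1)
  then have 1: "z \<otimes> x \<curlywedge> w \<otimes> y \<preceq> ?t \<otimes> (y\<^sup>l \<otimes> x)"
    by (intro le_trans[OF meet_le1]) auto
  have "w \<otimes> y \<preceq> w \<otimes> (x \<otimes> (x\<^sup>l \<otimes> y))" by (intro mult_left_mono le_mult_linv_mult) auto
  also have "\<dots> = w \<otimes> x \<otimes> (x\<^sup>l \<otimes> y)" by (simp add: m_assoc)
  finally have "w \<otimes> y \<preceq> ?t \<otimes> (x\<^sup>l \<otimes> y)"
    by (rule le_trans) (auto intro!: mult_right_mono join_ge2)
  then have 2: "z \<otimes> x \<curlywedge> w \<otimes> y \<preceq> ?t \<otimes> (x\<^sup>l \<otimes> y)"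
    by (intro le_trans[OF meet_le2]) auto
  have "z \<otimes> x \<curlywedge> w \<otimes> y \<preceq> ?t \<otimes> (y\<^sup>l \<otimes> x \<curlywedge> x\<^sup>l \<otimes> y)"
    using 1 2 by (simp add: mult_meet_left le_meet)
  moreover have "?t \<otimes> (y\<^sup>l \<otimes> x \<curlywedge> x\<^sup>l \<otimes> y) \<preceq> ?t \<otimes> \<one>"
    by (intro mult_left_mono linv_mult_meet_le_one) auto
  ultimately show ?thesis
    using le_trans[of "z \<otimes> x \<curlywedge> w \<otimes> y" "?t \<otimes> (y\<^sup>l \<otimes> x \<curlywedge> x\<^sup>l \<otimes> y)" ?t] by simp
qed

lemma translates_chain:
  assumes F: "prime_filter F" and [simp]: "x \<in> carrier A" "y \<in> carrier A"
  shows "translate x F \<subseteq> translate y F \<or> translate y F \<subseteq> translate x F"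
proof (rule ccontr)
  assume "\<not> ?thesis"
  then obtain z w where [simp]: "z \<in> carrier A" "w \<in> carrier A"
    and zw: "z \<otimes> x \<in> F" "z \<otimes> y \<notin> F" "w \<otimes> y \<in> F" "w \<otimes> x \<notin> F"
    by (auto simp: translate_def)
  have f: "lattice_filter F" using F by (simp add: prime_filter_def)
  have "z \<otimes> x \<curlywedge> w \<otimes> y \<in> F" using zw f by (simp add: lattice_filter_meet_iff)
  then have "z \<otimes> y \<curlyvee> w \<otimes> x \<in> F"
    using f cross_meet_le_join[of x y z w] unfolding lattice_filter_def by auto
  then show False using prime_filter_join_iff[OF F, of "z \<otimes> y" "w \<otimes> x"] zw by simp
qed

end

context periodic_lpregroup
begin

text \<open>A filter that is maximal among those containing \<open>x\<close> and avoiding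
  \<open>y\<close> is prime, by distributivity in the form \<open>cut_le\<close>.\<close>

lemma prime_filter_separates:
  assumes [simp]: "x \<in> carrier A" "y \<in> carrier A" and nle: "\<not> x \<preceq> y"
  obtains F where "prime_filter F" "x \<in> F" "y \<notin> F"
proof -
  let ?\<F> = "{F. lattice_filter F \<and> x \<in> F \<and> y \<notin> F}"
  let ?G = "{z \<in> carrier A. x \<preceq> z}"
  have "lattice_filter ?G"
    unfolding lattice_filter_def
  proof (intro conjI ballI impI)
    fix u v assume "u \<in> ?G" "v \<in> carrier A" "u \<preceq> v"
    then show "v \<in> ?G" using le_trans[of x u v] by auto
  qed (auto intro: le_meet)
  then have "?G \<in> ?\<F>" using nle by auto
  then have ne: "?\<F> \<noteq> {}" by blast
  have un: "\<Union>\<C> \<in> ?\<F>" if "\<C> \<noteq> {}" "subset.chain ?\<F> \<C>" for \<C>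
  proof -
    have ch: "\<And>F. F \<in> \<C> \<Longrightarrow> lattice_filter F \<and> x \<in> F \<and> y \<notin> F"
      "\<And>F G. F \<in> \<C> \<Longrightarrow> G \<in> \<C> \<Longrightarrow> F \<subseteq> G \<or> G \<subseteq> F"
      using that(2) by (auto simp: subset_chain_def)
    have "lattice_filter (\<Union>\<C>)"
      unfolding lattice_filter_def
    proof (intro conjI ballI impI)
      show "\<Union>\<C> \<subseteq> carrier A"
        by (rule Union_least) (use ch(1) in \<open>simp add: lattice_filter_def\<close>)
    next
      fix u v assume "u \<in> \<Union>\<C>" "v \<in> \<Union>\<C>"
      then obtain F where F: "F \<in> \<C>" "u \<in> F" "v \<in> F" using ch(2) by blast
      then have "u \<curlywedge> v \<in> F" using ch(1)[OF F(1)] by (simp add: lattice_filter_def)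
      then show "u \<curlywedge> v \<in> \<Union>\<C>" using F(1) by blast
    next
      fix u v assume "u \<in> \<Union>\<C>" "v \<in> carrier A" "u \<preceq> v"
      then obtain F where F: "F \<in> \<C>" "u \<in> F" "v \<in> carrier A" "u \<preceq> v" by blast
      then have "v \<in> F" using ch(1)[OF F(1)] by (simp add: lattice_filter_def)
      then show "v \<in> \<Union>\<C>" using F(1) by blast
    qed
    moreover have "\<exists>F. F \<in> \<C>" using that(1) by blast
    ultimately show ?thesis using ch(1) by blast
  qed
  obtain F where F: "F \<in> ?\<F>" and max: "\<forall>G \<in> ?\<F>. F \<subseteq> G \<longrightarrow> G = F"
    using subset_Zorn_nonempty[OF ne un] by (rule bexE)
  then have f: "lattice_filter F" and "x \<in> F" "y \<notin> F" by simp_all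
  then have sub: "F \<subseteq> carrier A" by (simp add: lattice_filter_def)
  \<comment> \<open>Maximality: the filter \<open>?H\<close> generated by \<open>F\<close> and
    \<open>u\<close> must contain \<open>y\<close>.\<close>
  have ext: "\<exists>f \<in> F. f \<curlywedge> u \<preceq> y" if [simp]: "u \<in> carrier A" and "u \<notin> F" for u
  proof (rule ccontr)
    assume no: "\<not> ?thesis"
    let ?H = "{z \<in> carrier A. \<exists>f \<in> F. f \<curlywedge> u \<preceq> z}"
    have "z \<in> ?H" if "z \<in> F" for z using that sub by (auto intro!: bexI[of _ z] meet_le1)
    then have "F \<subseteq> ?H" by blast
    moreover have "u \<in> ?H" using \<open>x \<in> F\<close> by (auto intro!: bexI[of _ x] meet_le2)
    moreover have "lattice_filter ?H"
      unfolding lattice_filter_def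
    proof (intro conjI ballI impI)
      fix v w assume "v \<in> ?H" "w \<in> ?H"
      then obtain f g where fg: "f \<in> F" "g \<in> F" "f \<curlywedge> u \<preceq> v" "g \<curlywedge> u \<preceq> w"
        and [simp]: "v \<in> carrier A" "w \<in> carrier A" by auto
      have [simp]: "f \<in> carrier A" "g \<in> carrier A" using fg sub by auto
      have "f \<curlywedge> g \<curlywedge> u \<preceq> f \<curlywedge> u" "f \<curlywedge> g \<curlywedge> u \<preceq> g \<curlywedge> u"
        by (auto intro!: le_meet intro: le_trans[OF meet_le1 meet_le1] le_trans[OF meet_le1 meet_le2] simp: meet_le2)
      then have "f \<curlywedge> g \<curlywedge> u \<preceq> v \<curlywedge> w"
        using fg le_trans[of "f \<curlywedge> g \<curlywedge> u" "f \<curlywedge> u" v] le_trans[of "f \<curlywedge> g \<curlywedge> u" "g \<curlywedge> u" w]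
        by (intro le_meet) simp_all
      moreover have "f \<curlywedge> g \<in> F" using fg f by (simp add: lattice_filter_meet_iff)
      ultimately show "v \<curlywedge> w \<in> ?H" by auto
    next
      fix v w assume "v \<in> ?H" "w \<in> carrier A" "v \<preceq> w"
      then obtain f where "f \<in> F" "f \<curlywedge> u \<preceq> v" "v \<in> carrier A" by auto
      moreover from this have "f \<curlywedge> u \<preceq> w"
        using le_trans[of "f \<curlywedge> u" v w] sub \<open>v \<preceq> w\<close> \<open>w \<in> carrier A\<close> by auto
      ultimately show "w \<in> ?H" using \<open>w \<in> carrier A\<close> by auto
    qed auto
    moreover have "y \<notin> ?H" using no by auto
    ultimately show False using bspec[OF max, of ?H] \<open>x \<in> F\<close> that(2) by blast
  qed
  have "u \<in> F \<or> v \<in> F" if [simp]: "u \<in> carrier A" "v \<in> carrier A" and uv: "u \<curlyvee> v \<in> F" for u v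
  proof (rule ccontr)
    assume "\<not> (u \<in> F \<or> v \<in> F)"
    then have "u \<notin> F" "v \<notin> F" by auto
    obtain f g where fg: "f \<in> F" "g \<in> F" "f \<curlywedge> u \<preceq> y" "g \<curlywedge> v \<preceq> y"
      using ext[of u] ext[of v] \<open>u \<notin> F\<close> \<open>v \<notin> F\<close> by auto
    have [simp]: "f \<in> carrier A" "g \<in> carrier A" using fg sub by auto
    \<comment> \<open>The element \<open>?w\<close> lies below \<open>u \<curlyvee> v\<close>, and
      its meets with \<open>u\<close> and with \<open>v\<close> lie below \<open>y\<close>. Cutting
      out first \<open>v\<close> and then \<open>u\<close> leaves \<open>?w \<preceq> y\<close>,
      although \<open>?w\<close> is in \<open>F\<close>.\<close>
    let ?w = "f \<curlywedge> g \<curlywedge> (u \<curlyvee> v)"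
    have w: "?w \<preceq> f" "?w \<preceq> g" "?w \<preceq> u \<curlyvee> v"
      by (auto intro: le_trans[OF meet_le1 meet_le1] le_trans[OF meet_le1 meet_le2] simp: meet_le2)
    have le: "p \<curlywedge> ?w \<preceq> y" if "?w \<preceq> q" "q \<curlywedge> p \<preceq> y" and [simp]: "p \<in> carrier A" "q \<in> carrier A" for p q
    proof -
      have "p \<curlywedge> ?w \<preceq> q \<curlywedge> p"
        using that(1) by (intro le_meet) (auto intro: le_trans[OF meet_le2] meet_le1)
      then show ?thesis using that(2) by (rule le_trans) auto
    qed
    have "?w \<preceq> u \<curlyvee> y"
    proof (rule cut_le)
      have "?w \<preceq> v \<curlyvee> (u \<curlyvee> y)"
        using le_trans[OF join_ge1[of u y] join_ge2[of v "u \<curlyvee> y"]]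
        by (intro le_trans[OF w(3)] join_le) (simp_all add: join_ge1)
      moreover have "v \<curlywedge> ?w \<preceq> u \<curlyvee> y"
        using le_trans[OF le[OF w(2) fg(4)] join_ge2[of u y]] by simp
      ultimately show "cut v ?w (u \<curlyvee> y)" by (simp add: cut_def)
    qed
    then have "cut u ?w y" using le[OF w(1) fg(3)] by (simp add: cut_def)
    then have "?w \<preceq> y" by (rule cut_le)
    moreover have "?w \<in> F" using fg uv f by (simp add: lattice_filter_meet_iff)
    ultimately show False using f \<open>y \<notin> F\<close> by (auto simp: lattice_filter_def)
  qed
  then have "prime_filter F" using f by (auto simp: prime_filter_def)
  then show thesis using that \<open>x \<in> F\<close> \<open>y \<notin> F\<close> by blast
qed

end

section \<open>Actions on chains\<close>

lemma linear_order_refl: "\<lbrakk>Linear_order \<Omega>; a \<in> Field \<Omega>\<rbrakk> \<Longrightarrow> (a, a) \<in> \<Omega>"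
  by (auto simp: order_on_defs refl_on_def)

lemma linear_order_antisym: "\<lbrakk>Linear_order \<Omega>; (a, b) \<in> \<Omega>; (b, a) \<in> \<Omega>\<rbrakk> \<Longrightarrow> a = b"
  by (auto simp: order_on_defs antisym_def)

lemma linear_order_trans: "\<lbrakk>Linear_order \<Omega>; (a, b) \<in> \<Omega>; (b, c) \<in> \<Omega>\<rbrakk> \<Longrightarrow> (a, c) \<in> \<Omega>"
  by (auto simp: order_on_defs trans_def)

lemma linear_order_total:
  "\<lbrakk>Linear_order \<Omega>; a \<in> Field \<Omega>; b \<in> Field \<Omega>\<rbrakk> \<Longrightarrow> (a, b) \<in> \<Omega> \<or> (b, a) \<in> \<Omega>"
  by (cases "a = b") (auto simp: order_on_defs total_on_def refl_on_def)

lemma max_in_eq: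
  "\<lbrakk>Linear_order \<Omega>; m \<in> S; \<And>x. x \<in> S \<Longrightarrow> (x, m) \<in> \<Omega>\<rbrakk> \<Longrightarrow> max_in \<Omega> S = m"
  unfolding max_in_def by (rule the_equality) (auto intro: linear_order_antisym)

lemma min_in_eq:
  "\<lbrakk>Linear_order \<Omega>; m \<in> S; \<And>x. x \<in> S \<Longrightarrow> (m, x) \<in> \<Omega>\<rbrakk> \<Longrightarrow> min_in \<Omega> S = m"
  unfolding min_in_def by (rule the_equality) (auto intro: linear_order_antisym)

lemma residual_eq:
  assumes "Linear_order \<Omega>" "residual_pair \<Omega> f g" shows "residual \<Omega> f = g"
proof
  fix b
  show "residual \<Omega> f b = g b"
  proof (cases "b \<in> Field \<Omega>")
    case True
    then have "g b \<in> Field \<Omega>" using assms by (auto simp: residual_pair_def)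
    then have "max_in \<Omega> {a \<in> Field \<Omega>. (f a, b) \<in> \<Omega>} = g b"
      using assms True by (intro max_in_eq) (auto simp: residual_pair_def linear_order_refl)
    then show ?thesis using True by (simp add: residual_def)
  next
    case False
    then show ?thesis using assms by (auto simp: residual_def residual_pair_def PiE_def extensional_def)
  qed
qed

lemma dual_residual_eq:
  assumes "Linear_order \<Omega>" "residual_pair \<Omega> g f" shows "dual_residual \<Omega> f = g"
proof
  fix a
  show "dual_residual \<Omega> f a = g a"
  proof (cases "a \<in> Field \<Omega>")
    case True
    then have ga: "g a \<in> Field \<Omega>" using assms by (auto simp: residual_pair_def)
    then have "(a, f (g a)) \<in> \<Omega>"
      using assms True linear_order_refl[OF assms(1) ga] by (auto simp: residual_pair_def)
    then have "min_in \<Omega> {b \<in> Field \<Omega>. (a, f b) \<in> \<Omega>} = g a"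
      using assms True ga by (intro min_in_eq) (auto simp: residual_pair_def)
    then show ?thesis using True by (simp add: dual_residual_def)
  next
    case False
    then show ?thesis using assms by (auto simp: dual_residual_def residual_pair_def PiE_def extensional_def)
  qed
qed

section \<open>Strict order and covers in a chain\<close>

definition below :: "'p rel \<Rightarrow> 'p \<Rightarrow> 'p \<Rightarrow> bool" where
  "below \<Omega> p q \<longleftrightarrow> (p, q) \<in> \<Omega> \<and> p \<noteq> q"

definition covers :: "'p rel \<Rightarrow> 'p \<Rightarrow> 'p \<Rightarrow> bool" where
  "covers \<Omega> p c \<longleftrightarrow> below \<Omega> p c \<and> (\<forall>d \<in> Field \<Omega>. below \<Omega> p d \<longrightarrow> (c, d) \<in> \<Omega>)"

lemma below_Field: "below \<Omega> p q \<Longrightarrow> p \<in> Field \<Omega> \<and> q \<in> Field \<Omega>"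
  by (auto simp: below_def intro: FieldI1 FieldI2)

lemma covers_Field: "covers \<Omega> p q \<Longrightarrow> p \<in> Field \<Omega> \<and> q \<in> Field \<Omega>"
  using below_Field[of \<Omega> p q] by (simp add: covers_def)

lemma not_le_iff_below:
  assumes "Linear_order \<Omega>" "p \<in> Field \<Omega>" "q \<in> Field \<Omega>"
  shows "(p, q) \<notin> \<Omega> \<longleftrightarrow> below \<Omega> q p"
  using linear_order_total[OF assms] linear_order_antisym[OF assms(1), of p q]
    linear_order_refl[OF assms(1,2)]
  by (auto simp: below_def)

lemma below_trans: "\<lbrakk>Linear_order \<Omega>; below \<Omega> p q; below \<Omega> q r\<rbrakk> \<Longrightarrow> below \<Omega> p r"
  using linear_order_trans[of \<Omega> p q r] linear_order_antisym[of \<Omega> p q] by (auto simp: below_def)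

lemma covers_iff:
  assumes "Linear_order \<Omega>"
  shows "covers \<Omega> p c \<longleftrightarrow> below \<Omega> p c \<and> (\<forall>d \<in> Field \<Omega>. \<not> (below \<Omega> p d \<and> below \<Omega> d c))"
proof (cases "c \<in> Field \<Omega>")
  case True
  have "(c, d) \<in> \<Omega> \<longleftrightarrow> \<not> below \<Omega> d c" if "d \<in> Field \<Omega>" for d
    using not_le_iff_below[OF assms True that] by auto
  then show ?thesis by (auto simp: covers_def)
next
  case False
  then have "\<not> below \<Omega> p c" using below_Field[of \<Omega> p c] by auto
  then show ?thesis by (simp add: covers_def)
qed

lemma covers_converse: "Linear_order \<Omega> \<Longrightarrow> covers (\<Omega>\<inverse>) c p \<longleftrightarrow> covers \<Omega> p c"
  by (simp add: covers_iff below_def) blast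

lemma covers_upper_unique:
  assumes "Linear_order \<Omega>" "covers \<Omega> p c" "covers \<Omega> p d" shows "c = d"
proof (rule linear_order_antisym[OF assms(1)])
  show "(c, d) \<in> \<Omega>" using assms(2,3) covers_Field[OF assms(3)] by (simp add: covers_def)
  show "(d, c) \<in> \<Omega>" using assms(2,3) covers_Field[OF assms(2)] by (simp add: covers_def)
qed

lemma covers_lower_unique: "\<lbrakk>Linear_order \<Omega>; covers \<Omega> p c; covers \<Omega> q c\<rbrakk> \<Longrightarrow> p = q"
  using covers_upper_unique[of "\<Omega>\<inverse>" c p q] by (simp add: covers_converse)

text \<open>On a chain, \<open>act_meet\<close> and \<open>act_join\<close> together with
  \<open>act_le\<close> say that meets and joins act as pointwise minima and maxima. Compatibility
  with the inversions follows: \<open>x \<otimes> x\<^sup>r \<preceq> \<one> \<preceq> x\<^sup>r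
  \<otimes> x\<close> makes the action of \<open>x\<^sup>r\<close> residual to that of
  \<open>x\<close>, see \<open>act_rinv\<close>.\<close>

locale chain_action = lpregroup +
  fixes \<Omega> :: "'p rel" and act :: "'a \<Rightarrow> 'p \<Rightarrow> 'p"
  assumes linear: "Linear_order \<Omega>"
    and act_closed: "\<lbrakk>x \<in> carrier A; p \<in> Field \<Omega>\<rbrakk> \<Longrightarrow> act x p \<in> Field \<Omega>"
    and act_one: "p \<in> Field \<Omega> \<Longrightarrow> act \<one> p = p"
    and act_mult: "\<lbrakk>x \<in> carrier A; y \<in> carrier A; p \<in> Field \<Omega>\<rbrakk> \<Longrightarrow> act (x \<otimes> y) p = act x (act y p)"
    and act_mono: "\<lbrakk>x \<in> carrier A; (p, q) \<in> \<Omega>\<rbrakk> \<Longrightarrow> (act x p, act x q) \<in> \<Omega>"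
    and act_le: "\<lbrakk>x \<in> carrier A; y \<in> carrier A; x \<preceq> y; p \<in> Field \<Omega>\<rbrakk> \<Longrightarrow> (act x p, act y p) \<in> \<Omega>"
    and act_meet: "\<lbrakk>x \<in> carrier A; y \<in> carrier A; p \<in> Field \<Omega>\<rbrakk> \<Longrightarrow> act (x \<curlywedge> y) p \<in> {act x p, act y p}"
    and act_join: "\<lbrakk>x \<in> carrier A; y \<in> carrier A; p \<in> Field \<Omega>\<rbrakk> \<Longrightarrow> act (x \<curlyvee> y) p \<in> {act x p, act y p}"
begin

lemma act_rinv:
  assumes x: "x \<in> carrier A" and p: "p \<in> Field \<Omega>" and q: "q \<in> Field \<Omega>"
  shows "(act x p, q) \<in> \<Omega> \<longleftrightarrow> (p, act (x\<^sup>r) q) \<in> \<Omega>"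
proof
  assume "(act x p, q) \<in> \<Omega>"
  then have "(act (x\<^sup>r) (act x p), act (x\<^sup>r) q) \<in> \<Omega>" using x by (intro act_mono) auto
  moreover have "(act \<one> p, act (x\<^sup>r \<otimes> x) p) \<in> \<Omega>"
    using x p by (intro act_le le_rinv_mult) auto
  ultimately show "(p, act (x\<^sup>r) q) \<in> \<Omega>"
    using x p linear_order_trans[OF linear] by (simp add: act_one act_mult)
next
  assume "(p, act (x\<^sup>r) q) \<in> \<Omega>"
  then have "(act x p, act x (act (x\<^sup>r) q)) \<in> \<Omega>" using x by (intro act_mono) auto
  moreover have "(act (x \<otimes> x\<^sup>r) q, act \<one> q) \<in> \<Omega>"
    using x q by (intro act_le mult_rinv_le) auto
  ultimately show "(act x p, q) \<in> \<Omega>"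
    using x q linear_order_trans[OF linear] by (simp add: act_one act_mult)
qed

definition rep :: "'a \<Rightarrow> 'p \<Rightarrow> 'p" where
  "rep x = (\<lambda>p \<in> Field \<Omega>. act x p)"

lemma rep_in: "x \<in> carrier A \<Longrightarrow> rep x \<in> Field \<Omega> \<rightarrow>\<^sub>E Field \<Omega>"
  by (auto simp: rep_def act_closed)

lemma residual_pair_rep: "x \<in> carrier A \<Longrightarrow> residual_pair \<Omega> (rep x) (rep (x\<^sup>r))"
  using rep_in[of x] rep_in[of "x\<^sup>r"] by (simp add: residual_pair_def rep_def act_rinv)

lemma residual_rep: "x \<in> carrier A \<Longrightarrow> residual \<Omega> (rep x) = rep (x\<^sup>r)"
  by (rule residual_eq[OF linear residual_pair_rep])

lemma dual_residual_rep: "x \<in> carrier A \<Longrightarrow> dual_residual \<Omega> (rep x) = rep (x\<^sup>l)"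
  using dual_residual_eq[OF linear residual_pair_rep[of "x\<^sup>l"]] by simp

lemma residual_funpow_rep: "x \<in> carrier A \<Longrightarrow> (residual \<Omega> ^^ k) (rep x) = rep ((rinv A ^^ k) x)"
  by (induction k) (simp_all add: residual_rep)

lemma dual_residual_funpow_rep:
  "x \<in> carrier A \<Longrightarrow> (dual_residual \<Omega> ^^ k) (rep x) = rep ((linv A ^^ k) x)"
  by (induction k) (simp_all add: dual_residual_rep)

lemma rep_in_F_chain:
  assumes "x \<in> carrier A" shows "rep x \<in> carrier (F_chain \<Omega>)"
proof -
  have "has_residual \<Omega> (rep y) \<and> has_dual_residual \<Omega> (rep y)" if "y \<in> carrier A" for y
    using residual_pair_rep[OF that] residual_pair_rep[of "y\<^sup>l"] that
    by (auto simp: has_residual_def has_dual_residual_def)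
  then show ?thesis
    using assms rep_in by (simp add: F_chain_def residual_funpow_rep dual_residual_funpow_rep)
qed

lemma rep_meet:
  assumes "x \<in> carrier A" "y \<in> carrier A"
  shows "rep (x \<curlywedge> y) = meet_op (F_chain \<Omega>) (rep x) (rep y)"
proof -
  have "min_in \<Omega> {act x p, act y p} = act (x \<curlywedge> y) p" if "p \<in> Field \<Omega>" for p
    using assms that act_le[of "x \<curlywedge> y" x p] act_le[of "x \<curlywedge> y" y p] act_meet[of x y p]
    by (intro min_in_eq linear) (auto simp: meet_le1 meet_le2)
  then show ?thesis by (auto simp: F_chain_def rep_def)
qed

lemma rep_join:
  assumes "x \<in> carrier A" "y \<in> carrier A"
  shows "rep (x \<curlyvee> y) = join_op (F_chain \<Omega>) (rep x) (rep y)"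
proof -
  have "max_in \<Omega> {act x p, act y p} = act (x \<curlyvee> y) p" if "p \<in> Field \<Omega>" for p
    using assms that act_le[of x "x \<curlyvee> y" p] act_le[of y "x \<curlyvee> y" p] act_join[of x y p]
    by (intro max_in_eq linear) (auto simp: join_ge1 join_ge2)
  then show ?thesis by (auto simp: F_chain_def rep_def)
qed

theorem rep_embedding:
  assumes faithful: "\<And>x y. \<lbrakk>x \<in> carrier A; y \<in> carrier A; x \<noteq> y\<rbrakk> \<Longrightarrow> \<exists>p \<in> Field \<Omega>. act x p \<noteq> act y p"
    and "periodic n A"
  shows "lpregroup_embedding rep A (Fn_chain n \<Omega>)"
proof -
  have in_Fn: "rep x \<in> carrier (Fn_chain n \<Omega>)" if "x \<in> carrier A" for x
    using assms(2) that rep_in_F_chain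
    by (simp add: Fn_chain_def periodic_def residual_funpow_rep dual_residual_funpow_rep)
  have mult: "rep (x \<otimes> y) = compose (Field \<Omega>) (rep x) (rep y)"
    if "x \<in> carrier A" "y \<in> carrier A" for x y
    using that by (auto simp: rep_def compose_def act_mult act_closed)
  have "inj_on rep (carrier A)"
  proof (rule inj_onI, rule ccontr)
    fix x y assume xy: "x \<in> carrier A" "y \<in> carrier A" "rep x = rep y" "x \<noteq> y"
    then obtain p where "p \<in> Field \<Omega>" "act x p \<noteq> act y p" using faithful by blast
    then show False using fun_cong[OF xy(3), of p] by (simp add: rep_def)
  qed
  then show ?thesis
    unfolding lpregroup_embedding_def mon_def hom_def
    using in_Fn mult rep_meet rep_join
    by (auto simp: Fn_chain_def F_chain_def residual_rep dual_residual_rep rep_def[of \<one>] act_one)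
qed

end

section \<open>Covers in a transitive residuated family\<close>

text \<open>A transitive family of residuated maps on a chain, stated symmetrically in the two residuals
  so that it can be read upside down.\<close>

locale residuated_family =
  fixes C :: "'a set" and lv rv :: "'a \<Rightarrow> 'a" and n :: nat
    and \<Omega> :: "'p rel" and act :: "'a \<Rightarrow> 'p \<Rightarrow> 'p"
  assumes linear: "Linear_order \<Omega>" and n_pos: "n \<ge> 1"
    and closed: "\<lbrakk>x \<in> C; p \<in> Field \<Omega>\<rbrakk> \<Longrightarrow> act x p \<in> Field \<Omega>"
    and lv: "x \<in> C \<Longrightarrow> lv x \<in> C" and rv: "x \<in> C \<Longrightarrow> rv x \<in> C"
    and lv_rv: "x \<in> C \<Longrightarrow> lv (rv x) = x" and rv_lv: "x \<in> C \<Longrightarrow> rv (lv x) = x"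
    and lv_period: "x \<in> C \<Longrightarrow> (lv ^^ (2 * n)) x = x"
    and rv_period: "x \<in> C \<Longrightarrow> (rv ^^ (2 * n)) x = x"
    and adj: "\<lbrakk>x \<in> C; p \<in> Field \<Omega>; q \<in> Field \<Omega>\<rbrakk> \<Longrightarrow> (act x p, q) \<in> \<Omega> \<longleftrightarrow> (p, act (rv x) q) \<in> \<Omega>"
    and transitive: "\<exists>a \<in> Field \<Omega>. \<forall>p \<in> Field \<Omega>. \<exists>x \<in> C. act x a = p"
begin

abbreviation below_in (infix "\<sqsubset>" 50) where "p \<sqsubset> q \<equiv> below \<Omega> p q"

lemmas not_le_iff = not_le_iff_below[OF linear]

lemma le_rv_act: "\<lbrakk>x \<in> C; p \<in> Field \<Omega>\<rbrakk> \<Longrightarrow> (p, act (rv x) (act x p)) \<in> \<Omega>"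
  using adj[of x p "act x p"] linear_order_refl[OF linear] closed by auto

lemma act_rv_le: "\<lbrakk>x \<in> C; p \<in> Field \<Omega>\<rbrakk> \<Longrightarrow> (act x (act (rv x) p), p) \<in> \<Omega>"
  using adj[of x "act (rv x) p" p] linear_order_refl[OF linear] closed rv by auto

lemma adj_lv:
  "\<lbrakk>x \<in> C; p \<in> Field \<Omega>; q \<in> Field \<Omega>\<rbrakk> \<Longrightarrow> (act (lv x) p, q) \<in> \<Omega> \<longleftrightarrow> (p, act x q) \<in> \<Omega>"
  using adj[of "lv x" p q] lv rv_lv by auto

text \<open>\<open>act (rv x) p\<close> is the greatest point that \<open>x\<close> sends to or
  below \<open>p\<close>, and \<open>act (lv x) c\<close> the least one that it sends to or above
  \<open>c\<close>. Nothing lies strictly between \<open>p\<close> and \<open>c\<close>, so these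
  two kinds of points fill the chain and the two extreme points are adjacent.\<close>

lemma covers_residuals:
  assumes x: "x \<in> C" and pc: "covers \<Omega> p c"
  shows "covers \<Omega> (act (rv x) p) (act (lv x) c)"
proof -
  have p: "p \<in> Field \<Omega>" and c: "c \<in> Field \<Omega>" and "p \<sqsubset> c"
    using pc covers_Field[OF pc] by (auto simp: covers_def)
  note F = closed[OF rv[OF x] p] closed[OF lv[OF x] c]
  have "(act (lv x) c, act (rv x) p) \<notin> \<Omega>"
  proof
    assume "(act (lv x) c, act (rv x) p) \<in> \<Omega>"
    then have "(c, act x (act (rv x) p)) \<in> \<Omega>" using adj_lv x c F by simp
    then have "(c, p) \<in> \<Omega>" using act_rv_le[OF x p] linear_order_trans[OF linear] by blast
    then show False using \<open>p \<sqsubset> c\<close> not_le_iff p c by blast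
  qed
  moreover have "(act (lv x) c, d) \<in> \<Omega>" if d: "d \<in> Field \<Omega>" "act (rv x) p \<sqsubset> d" for d
  proof -
    have "(d, act (rv x) p) \<notin> \<Omega>" using d F not_le_iff by blast
    then have "(act x d, p) \<notin> \<Omega>" using adj x d p by blast
    then have "p \<sqsubset> act x d" using not_le_iff closed x d p by blast
    then have "(c, act x d) \<in> \<Omega>" using pc closed x d by (auto simp: covers_def)
    then show ?thesis using adj_lv x c d by blast
  qed
  ultimately show ?thesis using not_le_iff F by (auto simp: covers_def)
qed

text \<open>\<open>act (rv (rv x)) p\<close> is the greatest \<open>z\<close> with
  \<open>act (rv x) z\<close> at most \<open>p\<close>, and \<open>act x p\<close> is the least
  \<open>z\<close> with \<open>act (rv x) z\<close> at least \<open>p\<close>. The two conditions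
  exhaust the chain, and \<open>ne\<close>, which says that \<open>p\<close> is not the top of its
  fibre under \<open>x\<close>, keeps \<open>act x p\<close> from satisfying the first.\<close>

lemma covers_below_fibre_top:
  assumes x: "x \<in> C" and p: "p \<in> Field \<Omega>" and ne: "act (rv x) (act x p) \<noteq> p"
  shows "covers \<Omega> (act (rv (rv x)) p) (act x p)"
proof -
  note F = closed[OF x p] closed[OF rv[OF rv[OF x]] p] closed[OF rv[OF x] closed[OF x p]]
  have key: "(z, act (rv (rv x)) p) \<in> \<Omega> \<longleftrightarrow> (act (rv x) z, p) \<in> \<Omega>" if "z \<in> Field \<Omega>" for z
    using adj[of "rv x" z p] rv x p that by blast
  have "(act (rv x) (act x p), p) \<notin> \<Omega>"
    using le_rv_act[OF x p] ne linear_order_antisym[OF linear] by blast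
  then have 1: "(act x p, act (rv (rv x)) p) \<notin> \<Omega>" using key F by blast
  have "(act x p, d) \<in> \<Omega>" if d: "d \<in> Field \<Omega>" "act (rv (rv x)) p \<sqsubset> d" for d
  proof -
    have "(d, act (rv (rv x)) p) \<notin> \<Omega>" using d F not_le_iff by blast
    then have "(act (rv x) d, p) \<notin> \<Omega>" using key d by blast
    then have "(p, act (rv x) d) \<in> \<Omega>"
      using linear_order_total[OF linear p closed[OF rv[OF x] d(1)]] by blast
    then show ?thesis using adj x p d by blast
  qed
  then show ?thesis using 1 not_le_iff F by (auto simp: covers_def)
qed

text \<open>If \<open>u\<close> is never the top of its fibre, then the iterated double residuals of \<open>h\<close> move \<open>h(u)\<close>
  down step by step, against periodicity.\<close>
lemma upper_cover_reflected:
  assumes h: "h \<in> C" and u: "u \<in> Field \<Omega>" and pc: "covers \<Omega> (act h u) c"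
  shows "\<exists>d. covers \<Omega> u d"
proof (rule ccontr)
  assume no: "\<not> ?thesis"
  let ?h = "\<lambda>k. (rv ^^ (2 * k)) h"
  have H: "?h k \<in> C" for k
    using h rv by (induction k) auto
  have step: "covers \<Omega> (act (?h (Suc k)) u) (act (?h k) u)" if "covers \<Omega> (act (?h k) u) d" for k d
  proof -
    have "act (rv (?h k)) (act (?h k) u) \<noteq> u"
      \<comment> \<open>The top of the fibre of \<open>u\<close> has an upper cover, since its image
        has one, whereas \<open>u\<close> has none by assumption.\<close>
      using covers_residuals[OF H[of k] that] no by metis
    from covers_below_fibre_top[OF H u this] show ?thesis by simp
  qed
  have cov: "\<exists>d. covers \<Omega> (act (?h k) u) d" for k
    by (induction k) (use pc step in auto)
  have dec: "act (?h (Suc k)) u \<sqsubset> act (?h k) u" for k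
    using cov[of k] step by (auto simp: covers_def)
  have "act (?h (Suc k)) u \<sqsubset> act h u" for k
  proof (induction k)
    case (Suc k)
    then show ?case
      using dec[of "Suc k"] linear_order_trans[OF linear] linear_order_antisym[OF linear]
      unfolding below_def by metis
  qed (use dec[of 0] in simp)
  from this[of "n - 1"] n_pos have "act (?h n) u \<sqsubset> act h u" by simp
  then show False using rv_period h by (simp add: below_def)
qed

text \<open>Reflection carries an upper cover from one point of the orbit to the generator
  \<open>a\<close>. From there it reaches every \<open>u = act x a\<close>: apply
  \<open>covers_residuals\<close> to \<open>lv x\<close>, whose right residual is \<open>x\<close>
  again.\<close>

lemma upper_covers:
  assumes pc: "covers \<Omega> p c" and u: "u \<in> Field \<Omega>"
  shows "\<exists>d. covers \<Omega> u d"
proof -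
  have p: "p \<in> Field \<Omega>" using pc covers_Field[OF pc] by (auto simp: covers_def)
  obtain a where a: "a \<in> Field \<Omega>" and tr: "\<And>p. p \<in> Field \<Omega> \<Longrightarrow> \<exists>x \<in> C. act x a = p"
    using transitive by blast
  obtain d where ad: "covers \<Omega> a d"
    using tr[OF p] upper_cover_reflected[OF _ a] pc by blast
  obtain x where x: "x \<in> C" "act x a = u" using tr[OF u] by blast
  have "covers \<Omega> (act (rv (lv x)) a) (act (lv (lv x)) d)"
    using covers_residuals[OF lv[OF x(1)] ad] .
  then show ?thesis using x rv_lv by auto
qed

end

text \<open>Turning the chain upside down exchanges residuals and dual residuals; lower covers are
  thereby reduced to upper ones.\<close>

lemma (in residuated_family) dual: "residuated_family C rv lv n (\<Omega>\<inverse>) act"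
proof
  show "Linear_order (\<Omega>\<inverse>)" using linear by simp
  fix x p q assume "x \<in> C" "p \<in> Field (\<Omega>\<inverse>)" "q \<in> Field (\<Omega>\<inverse>)"
  then show "(act x p, q) \<in> \<Omega>\<inverse> \<longleftrightarrow> (p, act (lv x) q) \<in> \<Omega>\<inverse>" using adj_lv by auto
qed (use n_pos closed lv rv lv_rv rv_lv lv_period rv_period transitive in auto)

context residuated_family
begin

lemma lower_covers:
  assumes pc: "covers \<Omega> p c" and u: "u \<in> Field \<Omega>"
  shows "\<exists>d. covers \<Omega> d u"
  using residuated_family.upper_covers[OF dual, of c p u] assms by (auto simp: covers_converse[OF linear])

text \<open>Of two points with the same image at most one is the top of the fibre. The other yields
  one covering pair, which spreads to upper and lower covers everywhere.\<close>

theorem injective_or_discrete: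
  assumes "x \<in> C" and "\<not> inj_on (act x) (Field \<Omega>)" and u: "u \<in> Field \<Omega>"
  shows "(\<exists>c. covers \<Omega> u c) \<and> (\<exists>c. covers \<Omega> c u)"
proof -
  obtain p q where pq: "p \<in> Field \<Omega>" "q \<in> Field \<Omega>" "act x p = act x q" "p \<noteq> q"
    using assms(2) by (auto simp: inj_on_def)
  have "act (rv x) (act x p) \<noteq> p \<or> act (rv x) (act x q) \<noteq> q" using pq by auto
  then obtain s t where "covers \<Omega> s t" using covers_below_fibre_top assms(1) pq by blast
  then show ?thesis using upper_covers lower_covers u by blast
qed

end

section \<open>Discrete chains are integral\<close>

locale discrete_chain =
  fixes W :: "'w rel"
  assumes linear: "Linear_order W"
    and ex_upper: "p \<in> Field W \<Longrightarrow> \<exists>c. covers W p c"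
    and ex_lower: "p \<in> Field W \<Longrightarrow> \<exists>c. covers W c p"
begin

definition next_pt :: "'w \<Rightarrow> 'w" where "next_pt p = (SOME c. covers W p c)"
definition prev_pt :: "'w \<Rightarrow> 'w" where "prev_pt p = (SOME c. covers W c p)"

lemma covers_next: "p \<in> Field W \<Longrightarrow> covers W p (next_pt p)"
  unfolding next_pt_def using ex_upper by (rule someI_ex)

lemma covers_prev: "p \<in> Field W \<Longrightarrow> covers W (prev_pt p) p"
  unfolding prev_pt_def using ex_lower by (rule someI_ex)

lemma next_closed: "p \<in> Field W \<Longrightarrow> next_pt p \<in> Field W"
  using covers_next covers_Field by fastforce

lemma prev_closed: "p \<in> Field W \<Longrightarrow> prev_pt p \<in> Field W"
  using covers_prev covers_Field by fastforce

lemma next_prev: "p \<in> Field W \<Longrightarrow> next_pt (prev_pt p) = p"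
  using covers_upper_unique[OF linear covers_next[OF prev_closed] covers_prev] .

lemma prev_next: "p \<in> Field W \<Longrightarrow> prev_pt (next_pt p) = p"
  using covers_lower_unique[OF linear covers_prev[OF next_closed] covers_next] .

section \<open>Integer translations along successors and predecessors\<close>

definition shift :: "int \<Rightarrow> 'w \<Rightarrow> 'w" where
  "shift k p = (if 0 \<le> k then (next_pt ^^ nat k) p else (prev_pt ^^ nat (- k)) p)"

lemma shift_0 [simp]: "shift 0 p = p" by (simp add: shift_def)

lemma shift_closed: "p \<in> Field W \<Longrightarrow> shift k p \<in> Field W"
proof -
  assume p: "p \<in> Field W"
  have "(next_pt ^^ m) p \<in> Field W" "(prev_pt ^^ m) p \<in> Field W" for m
    using p by (induction m) (auto simp: next_closed prev_closed)
  then show ?thesis by (simp add: shift_def)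
qed

lemma shift_Suc:
  assumes p: "p \<in> Field W" shows "shift (k + 1) p = next_pt (shift k p)"
proof (cases "0 \<le> k")
  case True
  then show ?thesis by (simp add: shift_def nat_add_distrib)
next
  case False
  \<comment> \<open>For negative \<open>k\<close> the shift by \<open>k\<close> takes one
    predecessor step more than the shift by \<open>k + 1\<close>, so the claim is obtained by
    undoing that step.\<close>
  then have "nat (- k) = Suc (nat (- (k + 1)))" by simp
  then have "shift k p = prev_pt (shift (k + 1) p)"
    using False by (auto simp: shift_def)
  then show ?thesis using p by (simp add: next_prev shift_closed)
qed

lemma shift_pred: "p \<in> Field W \<Longrightarrow> shift (k - 1) p = prev_pt (shift k p)"
  using shift_Suc[of p "k - 1"] prev_next[of "shift (k - 1) p"] by (simp add: shift_closed)

lemma shift_add: "p \<in> Field W \<Longrightarrow> shift (k + l) p = shift k (shift l p)"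
proof (induction k rule: int_induct[where k = 0])
  case (step1 i)
  then show ?case
    using shift_Suc[of p "i + l"] shift_Suc[of "shift l p" i] by (simp add: shift_closed algebra_simps)
next
  case (step2 i)
  then show ?case
    using shift_pred[of p "i + l"] shift_pred[of "shift l p" i] by (simp add: shift_closed algebra_simps)
qed simp

lemma shift_below:
  assumes p: "p \<in> Field W" shows "k < l \<Longrightarrow> below W (shift k p) (shift l p)"
proof (induction l rule: int_gr_induct)
  case base
  show ?case using shift_Suc[OF p] covers_next[OF shift_closed[OF p]] by (simp add: covers_def)
next
  case (step i)
  then show ?case
    using shift_Suc[OF p, of i] covers_next[OF shift_closed[OF p], of i] below_trans[OF linear]
    by (auto simp: covers_def)
qed

lemma shift_le_iff:
  assumes p: "p \<in> Field W" shows "(shift k p, shift l p) \<in> W \<longleftrightarrow> k \<le> l"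
  using shift_below[OF p, of k l] shift_below[OF p, of l k] linear_order_refl[OF linear shift_closed[OF p, of k]]
    not_le_iff_below[OF linear shift_closed[OF p, of k] shift_closed[OF p, of l]]
  by (cases k l rule: linorder_cases) (auto simp: below_def)

section \<open>Components: points at finite distance from each other\<close>

definition component :: "'w \<Rightarrow> 'w set" where "component p = range (\<lambda>k. shift k p)"

lemma component_shift: "p \<in> Field W \<Longrightarrow> component (shift k p) = component p"
  unfolding component_def
proof (intro equalityI image_subsetI)
  fix l assume p: "p \<in> Field W"
  show "shift l (shift k p) \<in> range (\<lambda>k. shift k p)" using shift_add[OF p] by (metis rangeI)
  have "shift l p = shift (l - k) (shift k p)" using shift_add[OF p, of "l - k" k] by simp
  then show "shift l p \<in> range (\<lambda>l. shift l (shift k p))" by simp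
qed

lemma self_in_component: "p \<in> component p"
  unfolding component_def by (metis rangeI shift_0)

lemma component_eq:
  assumes "p \<in> Field W" "q \<in> component p" shows "component q = component p"
proof -
  obtain k where "q = shift k p" using assms(2) by (auto simp: component_def)
  then show ?thesis using component_shift[OF assms(1)] by simp
qed

text \<open>A successor is a cover, so one step up from a point below \<open>q\<close> cannot pass
  \<open>q\<close>; nor can it land on \<open>q\<close>, which belongs to another component.\<close>

lemma shift_below_other:
  assumes p: "p \<in> Field W" and pq: "below W p q" "component p \<noteq> component q"
  shows "below W (shift k p) q"
proof (induction k rule: int_induct[where k = 0])
  case base
  show ?case using pq by simp
next
  case (step1 i)
  have "(shift (i + 1) p, q) \<in> W"
    using step1 covers_next[OF shift_closed[OF p], of i] below_Field[OF pq(1)] shift_Suc[OF p, of i]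
    by (simp add: covers_def)
  moreover have "shift (i + 1) p \<noteq> q" using pq(2) component_shift[OF p] by metis
  ultimately show ?case by (simp add: below_def)
next
  case (step2 i)
  then show ?case using shift_below[OF p, of "i - 1" i] below_trans[OF linear] by simp
qed

lemma shift_below_shift:
  assumes p: "p \<in> Field W" and q: "q \<in> Field W" and pq: "below W p q" "component p \<noteq> component q"
  shows "below W (shift k p) (shift l q)"
proof (rule ccontr)
  assume "\<not> ?thesis"
  then have le: "(shift l q, shift k p) \<in> W"
    using not_le_iff_below[OF linear shift_closed[OF q] shift_closed[OF p]] by blast
  have "shift l q \<noteq> shift k p" using pq(2) component_shift[OF p] component_shift[OF q] by metis
  then have "below W (shift l q) (shift k p)" using le by (simp add: below_def)
  \<comment> \<open>Were the shifted points in the wrong order, undoing the shift of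
    \<open>q\<close> would put \<open>q\<close> itself strictly below \<open>shift k p\<close>,
    against \<open>shift_below_other\<close>.\<close>
  then have "below W (shift (- l) (shift l q)) (shift k p)"
    by (rule shift_below_other[rotated]) (use pq(2) p q in \<open>simp_all add: component_shift shift_closed\<close>)
  then have "below W q (shift k p)" using shift_add[OF q, of "- l" l] by simp
  moreover have "below W (shift k p) q" by (rule shift_below_other[OF p pq])
  ultimately show False using linear_order_antisym[OF linear] by (auto simp: below_def)
qed

text \<open>The choice depends on the component as a set only, so all of its points get the same
  representative.\<close>

definition root :: "'w \<Rightarrow> 'w" where "root p = (SOME q. q \<in> component p)"

lemma root_in: "root p \<in> component p"
  unfolding root_def using self_in_component by (rule someI)

lemma root_eq: "component p = component q \<Longrightarrow> root p = root q"
  by (simp add: root_def)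

text \<open>The representatives may be renamed by \<open>c\<close> in order to move them to a prescribed type.\<close>
theorem iso_lex_Z:
  fixes c :: "'w \<Rightarrow> 'q"
  assumes inj: "inj_on c (Field W)"
  obtains J :: "'q rel" and \<phi> where "bij_betw \<phi> (Field (lex_Z J)) (Field W)" "Linear_order J"
    "\<And>u v. \<lbrakk>u \<in> Field (lex_Z J); v \<in> Field (lex_Z J)\<rbrakk> \<Longrightarrow> (u, v) \<in> lex_Z J \<longleftrightarrow> (\<phi> u, \<phi> v) \<in> W"
proof -
  define R where "R = root ` Field W"
  define d where "d = inv_into (Field W) c"
  define J where "J = {(c p, c q) | p q. p \<in> R \<and> q \<in> R \<and> (p, q) \<in> W}"
  define \<phi> where "\<phi> = (\<lambda>(j, k). shift k (d j))"
  have RF: "R \<subseteq> Field W"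
    unfolding R_def
  proof (rule image_subsetI)
    fix p assume "p \<in> Field W"
    moreover obtain k where "root p = shift k p" using root_in[of p] by (auto simp: component_def)
    ultimately show "root p \<in> Field W" by (simp add: shift_closed)
  qed
  then have d: "d (c p) = p" if "p \<in> R" for p
    using inv_into_f_f[OF inj subsetD[OF RF that]] by (simp add: d_def)
  have comp_eq: "p = q" if pq: "p \<in> R" "q \<in> R" "component p = component q" for p q
  proof -
    obtain p' q' where p': "p' \<in> Field W" "p = root p'" and q': "q' \<in> Field W" "q = root q'"
      using pq unfolding R_def by blast
    then have "component p' = component q'"
      using component_eq[OF p'(1) root_in] component_eq[OF q'(1) root_in] pq(3) by simp
    then show ?thesis unfolding p'(2) q'(2) by (rule root_eq)
  qed
  have J_iff: "(c p, c q) \<in> J \<longleftrightarrow> (p, q) \<in> W" if "p \<in> R" "q \<in> R" for p q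
  proof
    assume "(c p, c q) \<in> J"
    then have "\<exists>p' q'. (c p, c q) = (c p', c q') \<and> p' \<in> R \<and> q' \<in> R \<and> (p', q') \<in> W"
      unfolding J_def by (rule CollectD)
    then obtain p' q' where *: "(c p, c q) = (c p', c q')" "p' \<in> R" "q' \<in> R" "(p', q') \<in> W"
      by (elim exE conjE)
    then have "d (c p) = d (c p')" "d (c q) = d (c q')" by simp_all
    then have "p = p'" "q = q'"
      unfolding d[OF that(1)] d[OF that(2)] d[OF *(2)] d[OF *(3)] .
    then show "(p, q) \<in> W" using *(4) by simp
  next
    assume "(p, q) \<in> W"
    then show "(c p, c q) \<in> J"
      using that unfolding J_def by blast
  qed
  have RF': "p \<in> Field W" if "p \<in> R" for p using RF that by blast
  have refl: "(c p, c p) \<in> J" if "p \<in> R" for p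
    using that J_iff linear_order_refl[OF linear RF'] by simp
  have FJ: "Field J = c ` R"
  proof
    show "Field J \<subseteq> c ` R" by (auto simp: Field_def J_def)
    show "c ` R \<subseteq> Field J"
      by (rule image_subsetI, rule FieldI1, rule refl)
  qed
  have "Linear_order J"
    unfolding linear_order_on_def partial_order_on_def preorder_on_def
  proof (intro conjI)
    show "J \<subseteq> Field J \<times> Field J" by (auto intro: FieldI1 FieldI2)
    show "refl_on (Field J) J" by (rule refl_onI) (auto simp: FJ refl)
    show "trans J"
    proof (rule transI)
      fix x y z assume xyz: "(x, y) \<in> J" "(y, z) \<in> J"
      obtain p where p: "x = c p" "p \<in> R" using FieldI1[OF xyz(1)] unfolding FJ by (rule imageE)
      obtain q where q: "y = c q" "q \<in> R" using FieldI1[OF xyz(2)] unfolding FJ by (rule imageE)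
      obtain r where r: "z = c r" "r \<in> R" using FieldI2[OF xyz(2)] unfolding FJ by (rule imageE)
      show "(x, z) \<in> J"
        using xyz linear_order_trans[OF linear, of p q r] p(2) q(2) r(2)
        by (simp only: p(1) q(1) r(1) J_iff)
    qed
    show "antisym J"
    proof (rule antisymI)
      fix x y assume xy: "(x, y) \<in> J" "(y, x) \<in> J"
      obtain p where p: "x = c p" "p \<in> R" using FieldI1[OF xy(1)] unfolding FJ by (rule imageE)
      obtain q where q: "y = c q" "q \<in> R" using FieldI1[OF xy(2)] unfolding FJ by (rule imageE)
      have "p = q"
        using xy linear_order_antisym[OF linear, of p q] p(2) q(2)
        by (simp only: p(1) q(1) J_iff)
      then show "x = y" by (simp add: p q)
    qed
    show "total_on (Field J) J"
    proof (rule total_onI)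
      fix x y assume xy: "x \<in> Field J" "y \<in> Field J"
      obtain p where p: "x = c p" "p \<in> R" using xy(1) unfolding FJ by (rule imageE)
      obtain q where q: "y = c q" "q \<in> R" using xy(2) unfolding FJ by (rule imageE)
      show "(x, y) \<in> J \<or> (y, x) \<in> J"
        using linear_order_total[OF linear RF'[OF p(2)] RF'[OF q(2)]] p(2) q(2)
        by (simp only: p(1) q(1) J_iff)
    qed
  qed
  have FL: "Field (lex_Z J) = Field J \<times> UNIV"
  proof
    show "Field (lex_Z J) \<subseteq> Field J \<times> UNIV" by (auto simp: Field_def lex_Z_def)
    have "((j, k), (j, k)) \<in> lex_Z J" if "j \<in> Field J" for j k
      using that by (auto simp: lex_Z_def)
    then show "Field J \<times> UNIV \<subseteq> Field (lex_Z J)" by (auto intro: FieldI1)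
  qed
  have iso: "(u, v) \<in> lex_Z J \<longleftrightarrow> (\<phi> u, \<phi> v) \<in> W"
    if uv: "u \<in> Field (lex_Z J)" "v \<in> Field (lex_Z J)" for u v
  proof -
    obtain p k where u: "u = (c p, k)" and p: "p \<in> R" using uv(1) FL FJ by auto
    obtain q l where v: "v = (c q, l)" and q: "q \<in> R" using uv(2) FL FJ by auto
    have pq: "p \<in> Field W" "q \<in> Field W" using p q RF by auto
    show ?thesis
    proof (cases "p = q")
      case True
      then show ?thesis using p pq FJ shift_le_iff by (auto simp: u v lex_Z_def \<phi>_def d)
    next
      case False
      then have ne: "component p \<noteq> component q" "c p \<noteq> c q" using comp_eq p q d by metis+
      have "(u, v) \<in> lex_Z J \<longleftrightarrow> (p, q) \<in> W"
        using ne J_iff[OF p q] by (auto simp: u v lex_Z_def)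
      also have "\<dots> \<longleftrightarrow> (shift k p, shift l q) \<in> W"
      proof
        assume "(p, q) \<in> W"
        then show "(shift k p, shift l q) \<in> W"
          using shift_below_shift[OF pq _ ne(1), of k l] False by (simp add: below_def)
      next
        assume le: "(shift k p, shift l q) \<in> W"
        show "(p, q) \<in> W"
        proof (rule ccontr)
          assume "(p, q) \<notin> W"
          then have "below W q p" using not_le_iff_below[OF linear] pq by blast
          then have "below W (shift l q) (shift k p)"
            using shift_below_shift[OF pq(2,1)] ne(1) by metis
          then show False
            using not_le_iff_below[OF linear] le shift_closed pq by blast
        qed
      qed
      finally show ?thesis by (simp add: u v \<phi>_def d p q)
    qed
  qed
  have "bij_betw \<phi> (Field (lex_Z J)) (Field W)"
  proof (rule bij_betw_imageI)
    show "inj_on \<phi> (Field (lex_Z J))"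
    proof (rule inj_onI)
      fix u v assume uv: "u \<in> Field (lex_Z J)" "v \<in> Field (lex_Z J)" "\<phi> u = \<phi> v"
      obtain p k where u: "u = (c p, k)" and p: "p \<in> R" using uv(1) FL FJ by auto
      obtain q l where v: "v = (c q, l)" and q: "q \<in> R" using uv(2) FL FJ by auto
      have e: "shift k p = shift l q" using uv(3) by (simp add: u v \<phi>_def d p q)
      then have "p = q" using comp_eq[OF p q] component_shift p q RF by (metis subsetD)
      moreover have "k = l"
      proof -
        have pF: "p \<in> Field W" using p RF by auto
        then show ?thesis
          using e \<open>p = q\<close> shift_le_iff[OF pF, of k l] shift_le_iff[OF pF, of l k]
            linear_order_refl[OF linear shift_closed[OF pF]] by simp
      qed
      ultimately show "u = v" by (simp add: u v)
    qed
    show "\<phi> ` Field (lex_Z J) = Field W"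
    proof
      show "\<phi> ` Field (lex_Z J) \<subseteq> Field W"
        using RF by (auto simp: FL FJ \<phi>_def d shift_closed)
      show "Field W \<subseteq> \<phi> ` Field (lex_Z J)"
      proof
        fix p assume p: "p \<in> Field W"
        have "component (root p) = component p" using component_eq[OF p root_in] .
        then obtain k where "p = shift k (root p)"
          using self_in_component[of p] by (auto simp: component_def)
        then have "p = \<phi> (c (root p), k)" using p by (simp add: \<phi>_def d R_def)
        moreover have "(c (root p), k) \<in> Field (lex_Z J)" using p by (auto simp: FL FJ R_def)
        ultimately show "p \<in> \<phi> ` Field (lex_Z J)" by blast
      qed
    qed
  qed
  then show thesis using that \<open>Linear_order J\<close> iso by blast
qed

end

section \<open>The representation\<close>

lemma linear_order_iso:
  assumes W: "Linear_order W" and inj: "inj_on \<phi> (Field \<Omega>)" and sub: "\<phi> ` Field \<Omega> \<subseteq> Field W"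
    and iso: "\<And>u v. \<lbrakk>u \<in> Field \<Omega>; v \<in> Field \<Omega>\<rbrakk> \<Longrightarrow> (u, v) \<in> \<Omega> \<longleftrightarrow> (\<phi> u, \<phi> v) \<in> W"
  shows "Linear_order \<Omega>"
  unfolding linear_order_on_def partial_order_on_def preorder_on_def
proof (intro conjI)
  show "\<Omega> \<subseteq> Field \<Omega> \<times> Field \<Omega>" by (auto intro: FieldI1 FieldI2)
  show "refl_on (Field \<Omega>) \<Omega>"
    by (rule refl_onI) (use iso linear_order_refl[OF W] sub in auto)
  show "trans \<Omega>"
  proof (rule transI)
    fix x y z assume xyz: "(x, y) \<in> \<Omega>" "(y, z) \<in> \<Omega>"
    note F = FieldI1[OF xyz(1)] FieldI2[OF xyz(1)] FieldI2[OF xyz(2)]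
    show "(x, z) \<in> \<Omega>"
      using xyz linear_order_trans[OF W, of "\<phi> x" "\<phi> y" "\<phi> z"] by (simp only: iso F)
  qed
  show "antisym \<Omega>"
  proof (rule antisymI)
    fix x y assume xy: "(x, y) \<in> \<Omega>" "(y, x) \<in> \<Omega>"
    note F = FieldI1[OF xy(1)] FieldI2[OF xy(1)]
    have "\<phi> x = \<phi> y"
      using xy linear_order_antisym[OF W, of "\<phi> x" "\<phi> y"] by (simp only: iso F)
    then show "x = y" using inj F by (simp add: inj_on_eq_iff)
  qed
  show "total_on (Field \<Omega>) \<Omega>"
  proof (rule total_onI)
    fix x y assume F: "x \<in> Field \<Omega>" "y \<in> Field \<Omega>"
    then have "\<phi> x \<in> Field W" "\<phi> y \<in> Field W" using sub by auto
    from linear_order_total[OF W this] show "(x, y) \<in> \<Omega> \<or> (y, x) \<in> \<Omega>" by (simp only: iso F)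
  qed
qed

lemma (in chain_action) transport:
  assumes bij: "bij_betw \<phi> (Field \<Omega>') (Field \<Omega>)"
    and iso: "\<And>u v. \<lbrakk>u \<in> Field \<Omega>'; v \<in> Field \<Omega>'\<rbrakk> \<Longrightarrow> (u, v) \<in> \<Omega>' \<longleftrightarrow> (\<phi> u, \<phi> v) \<in> \<Omega>"
  shows "chain_action A \<Omega>' (\<lambda>x u. inv_into (Field \<Omega>') \<phi> (act x (\<phi> u)))"
proof -
  let ?\<psi> = "inv_into (Field \<Omega>') \<phi>"
  have \<phi>: "\<phi> u \<in> Field \<Omega>" if "u \<in> Field \<Omega>'" for u using that bij by (auto simp: bij_betw_def)
  have \<psi>: "?\<psi> p \<in> Field \<Omega>'" "\<phi> (?\<psi> p) = p" if "p \<in> Field \<Omega>" for p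
    using that bij by (auto simp: bij_betw_def inv_into_into f_inv_into_f)
  have \<psi>\<phi>: "?\<psi> (\<phi> u) = u" if "u \<in> Field \<Omega>'" for u
    using that bij by (simp add: bij_betw_def)
  have le: "(?\<psi> p, ?\<psi> q) \<in> \<Omega>'" if "(p, q) \<in> \<Omega>" for p q
    using that iso[OF \<psi>(1) \<psi>(1)] \<psi>(2) FieldI1[OF that] FieldI2[OF that] by simp
  show ?thesis
  proof
    show "Linear_order \<Omega>'"
      using linear_order_iso[OF linear, of \<phi> \<Omega>'] bij iso by (auto simp: bij_betw_def)
  next
    fix x u v assume x: "x \<in> carrier A" and uv: "(u, v) \<in> \<Omega>'"
    then have "(\<phi> u, \<phi> v) \<in> \<Omega>" using iso FieldI1[OF uv] FieldI2[OF uv] by simp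
    then show "(?\<psi> (act x (\<phi> u)), ?\<psi> (act x (\<phi> v))) \<in> \<Omega>'" using x by (intro le act_mono)
  next
    fix x y u assume "x \<in> carrier A" "y \<in> carrier A" "u \<in> Field \<Omega>'"
    note a = this(1,2) \<phi>[OF this(3)]
    show "?\<psi> (act (x \<otimes> y) (\<phi> u)) = ?\<psi> (act x (\<phi> (?\<psi> (act y (\<phi> u)))))"
      using a by (simp add: \<psi> act_closed act_mult)
    show "?\<psi> (act (x \<curlywedge> y) (\<phi> u)) \<in> {?\<psi> (act x (\<phi> u)), ?\<psi> (act y (\<phi> u))}"
      using act_meet[OF a] by auto
    show "?\<psi> (act (x \<curlyvee> y) (\<phi> u)) \<in> {?\<psi> (act x (\<phi> u)), ?\<psi> (act y (\<phi> u))}"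
      using act_join[OF a] by auto
    show "(?\<psi> (act x (\<phi> u)), ?\<psi> (act y (\<phi> u))) \<in> \<Omega>'" if "x \<preceq> y"
      using a that by (intro le act_le)
  qed (simp_all add: \<phi> \<psi> \<psi>\<phi> act_closed act_one)
qed

section \<open>The orbit of a prime filter, ordered by inclusion\<close>

context lpregroup
begin

definition orbit :: "'a set \<Rightarrow> 'a set set" where
  "orbit F = (\<lambda>x. translate x F) ` carrier A"

definition orbit_order :: "'a set \<Rightarrow> 'a set rel" where
  "orbit_order F = {(S, T). S \<in> orbit F \<and> T \<in> orbit F \<and> S \<subseteq> T}"

lemma orbit_order_iff: "(S, T) \<in> orbit_order F \<longleftrightarrow> S \<in> orbit F \<and> T \<in> orbit F \<and> S \<subseteq> T"
  by (simp add: orbit_order_def)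

lemma Field_orbit_order [simp]: "Field (orbit_order F) = orbit F"
  by (auto simp: Field_def orbit_order_def)

lemma orbit_prime: "\<lbrakk>prime_filter F; S \<in> orbit F\<rbrakk> \<Longrightarrow> prime_filter S"
  by (auto simp: orbit_def prime_filter_translate)

lemma orbit_subset: "S \<in> orbit F \<Longrightarrow> S \<subseteq> carrier A"
  by (auto simp: orbit_def translate_def)

lemma orbit_self: "prime_filter F \<Longrightarrow> F \<in> orbit F"
  unfolding orbit_def by (rule image_eqI[of _ _ \<one>]) (auto simp: translate_one prime_filter_def lattice_filter_def)

lemma translate_orbit: "\<lbrakk>x \<in> carrier A; S \<in> orbit F\<rbrakk> \<Longrightarrow> translate x S \<in> orbit F"
  by (auto simp: orbit_def translate_mult[symmetric])

lemma orbit_chain: "\<lbrakk>prime_filter F; S \<in> orbit F; T \<in> orbit F\<rbrakk> \<Longrightarrow> S \<subseteq> T \<or> T \<subseteq> S"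
  using translates_chain by (auto simp: orbit_def)

lemma orbit_order_linear: "prime_filter F \<Longrightarrow> Linear_order (orbit_order F)"
  using orbit_chain[of F]
  by (auto simp: order_on_defs total_on_def refl_on_def antisym_def trans_def)
    (auto simp: orbit_order_iff)

lemma chain_action_orbit:
  assumes F: "prime_filter F" shows "chain_action A (orbit_order F) translate"
proof
  show "Linear_order (orbit_order F)" by (rule orbit_order_linear[OF F])
next
  fix x y S assume a: "x \<in> carrier A" "y \<in> carrier A" "S \<in> Field (orbit_order F)"
  then have o: "S \<in> orbit F" and S: "prime_filter S" using orbit_prime[OF F] by simp_all
  have c: "translate x S \<subseteq> translate y S \<or> translate y S \<subseteq> translate x S"
    by (rule translates_chain[OF S a(1,2)])
  show "translate (x \<curlywedge> y) S \<in> {translate x S, translate y S}"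
    using c by (auto simp: translate_meet[OF S a(1,2)])
  show "translate (x \<curlyvee> y) S \<in> {translate x S, translate y S}"
    using c by (auto simp: translate_join[OF S a(1,2)])
  show "(translate x S, translate y S) \<in> orbit_order F" if "x \<preceq> y"
    using a(1,2) o that translate_le[OF S a(1,2)] by (simp add: orbit_order_iff translate_orbit)
qed (auto simp: translate_orbit translate_one orbit_subset translate_mult orbit_order_iff
    dest: subsetD[OF translate_mono])

end

context periodic_lpregroup
begin

lemma residuated_family_orbit:
  assumes F: "prime_filter F"
  shows "residuated_family (carrier A) (linv A) (rinv A) n (orbit_order F) translate"
proof -
  interpret o: chain_action A "orbit_order F" translate by (rule chain_action_orbit[OF F])
  show ?thesis
  proof (rule residuated_family.intro)
    show "Linear_order (orbit_order F)" by (rule o.linear)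
    show "n \<ge> 1" by (rule n_pos)
    show "\<exists>a \<in> Field (orbit_order F). \<forall>p \<in> Field (orbit_order F). \<exists>x \<in> carrier A. translate x a = p"
      unfolding Field_orbit_order
      by (rule bexI[of _ F, OF _ orbit_self[OF F]]) (auto simp: orbit_def)
    show "x \<in> carrier A \<Longrightarrow> (linv A ^^ (2 * n)) x = x" for x by (rule periodic_linv[OF per])
    show "x \<in> carrier A \<Longrightarrow> (rinv A ^^ (2 * n)) x = x" for x by (rule periodic_rinv[OF per])
  qed (fact o.act_closed o.act_rinv linv_closed rinv_closed linv_rinv rinv_linv)+
qed

definition discrete :: "'a set \<Rightarrow> bool" where
  "discrete F \<longleftrightarrow> (\<forall>S \<in> orbit F. (\<exists>c. covers (orbit_order F) S c) \<and> (\<exists>c. covers (orbit_order F) c S))"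

text \<open>Contrapositive of \<open>injective_or_discrete\<close>; it supplies the strictness on
  which the blow-up depends.\<close>

lemma translate_inj:
  assumes "prime_filter F" "\<not> discrete F" "x \<in> carrier A" shows "inj_on (translate x) (orbit F)"
proof (rule ccontr)
  interpret o: residuated_family "carrier A" "linv A" "rinv A" n "orbit_order F" translate
    by (rule residuated_family_orbit[OF assms(1)])
  assume "\<not> inj_on (translate x) (orbit F)"
  then have "discrete F"
    using o.injective_or_discrete[OF assms(3)] unfolding discrete_def Field_orbit_order by blast
  then show False using assms(2) by blast
qed

text \<open>The algebra preserves each orbit, so the orbits may be summed in any order; the
  well-ordering theorem provides one.\<close>

definition filter_order :: "'a set rel" where
  "filter_order = (SOME r. Linear_order r \<and> Field r = UNIV)"

lemma filter_order: "Linear_order filter_order" "Field filter_order = UNIV"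
proof -
  obtain r :: "'a set rel" where r: "Well_order r \<and> Field r = UNIV"
    using well_ordering by (rule exE)
  then have "Linear_order r \<and> Field r = UNIV" unfolding well_order_on_def by metis
  then have "\<exists>r :: 'a set rel. Linear_order r \<and> Field r = UNIV" by (rule exI)
  then have "Linear_order filter_order \<and> Field filter_order = UNIV"
    unfolding filter_order_def by (rule someI_ex)
  then show "Linear_order filter_order" "Field filter_order = UNIV" by auto
qed

text \<open>On a non-discrete orbit all maps are injective, so every point can be blown up to a copy of
  the integers on which they act trivially.\<close>

definition points :: "('a set \<times> 'a set \<times> int) set" where
  "points = {(F, S, k). prime_filter F \<and> S \<in> orbit F \<and> (discrete F \<longrightarrow> k = 0)}"

definition points_le :: "'a set \<times> 'a set \<times> int \<Rightarrow> 'a set \<times> 'a set \<times> int \<Rightarrow> bool" where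
  "points_le = (\<lambda>(F, S, k) (G, T, l).
     F \<noteq> G \<and> (F, G) \<in> filter_order \<or> F = G \<and> (S \<subset> T \<or> S = T \<and> k \<le> l))"

definition points_order :: "('a set \<times> 'a set \<times> int) rel" where
  "points_order = {(p, q). p \<in> points \<and> q \<in> points \<and> points_le p q}"

definition points_act :: "'a \<Rightarrow> 'a set \<times> 'a set \<times> int \<Rightarrow> 'a set \<times> 'a set \<times> int" where
  "points_act x = (\<lambda>(F, S, k). (F, translate x S, k))"

lemma points_order_iff: "(p, q) \<in> points_order \<longleftrightarrow> p \<in> points \<and> q \<in> points \<and> points_le p q"
  by (simp add: points_order_def)

lemma Field_points_order [simp]: "Field points_order = points"
  by (auto simp: Field_def points_order_def points_le_def)

lemma points_order_linear: "Linear_order points_order"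
  unfolding linear_order_on_def partial_order_on_def preorder_on_def
proof (intro conjI)
  show "points_order \<subseteq> Field points_order \<times> Field points_order" by (auto intro: FieldI1 FieldI2 simp del: Field_points_order)
  show "refl_on (Field points_order) points_order"
    by (rule refl_onI) (auto simp: points_order_iff points_le_def)
  have tr: "points_le (F, S, k) (H, U, m)"
    if "points_le (F, S, k) (G, T, l)" "points_le (G, T, l) (H, U, m)" for F S k G T l H U m
    using that linear_order_trans[OF filter_order(1), of F G H]
      linear_order_antisym[OF filter_order(1), of F G]
    by (auto simp: points_le_def)
  show "trans points_order"
    by (rule transI) (auto simp: points_order_iff intro: tr)
  have as: "p = q" if "points_le p q" "points_le q p" for p q
    using that linear_order_antisym[OF filter_order(1), of "fst p" "fst q"]
    by (auto simp: points_le_def split: prod.splits)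
  show "antisym points_order"
    by (rule antisymI, rule as) (simp_all add: points_order_iff)
  show "total_on (Field points_order) points_order"
  proof (rule total_onI)
    fix p q assume pq: "p \<in> Field points_order" "q \<in> Field points_order"
    obtain F S k G T l where e: "p = (F, S, k)" "q = (G, T, l)" by (metis prod_cases3)
    have "points_le p q \<or> points_le q p"
    proof (cases "F = G")
      case True
      then show ?thesis using pq orbit_chain[of G S T] by (auto simp: e points_le_def points_def)
    next
      case False
      then show ?thesis using linear_order_total[OF filter_order(1), of F G]
        by (auto simp: e points_le_def filter_order(2))
    qed
    then show "(p, q) \<in> points_order \<or> (q, p) \<in> points_order" using pq by (auto simp: points_order_iff)
  qed
qed

lemma chain_action_points: "chain_action A points_order points_act"
proof
  show "Linear_order points_order" by (rule points_order_linear)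
next
  fix x p q assume x: "x \<in> carrier A" and pq: "(p, q) \<in> points_order"
  obtain F S k G T l where e: "p = (F, S, k)" "q = (G, T, l)" by (metis prod_cases3)
  have p: "p \<in> points" "q \<in> points" "points_le p q" using pq by (auto simp: points_order_iff)
  \<comment> \<open>On a discrete orbit both levels are \<open>0\<close>, so it does no harm if
    \<open>x\<close> identifies \<open>S\<close> and \<open>T\<close>. On any other orbit
    \<open>k\<close> may exceed \<open>l\<close> while \<open>S \<subset> T\<close>, and injectivity
    has to keep the images apart.\<close>
  have "F = G \<Longrightarrow> translate x S \<subset> translate x T \<or> translate x S = translate x T \<and> k \<le> l"
  proof (cases "discrete G")
    case True
    assume "F = G"
    then show ?thesis using True p translate_mono[of S T x] by (auto simp: e points_le_def points_def)
  next
    case False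
    assume "F = G"
    then show ?thesis
      using inj_onD[OF translate_inj[OF _ False x], of S T] p translate_mono[of S T x]
      by (auto simp: e points_le_def points_def)
  qed
  then show "(points_act x p, points_act x q) \<in> points_order"
    using p x by (auto simp: e points_order_iff points_le_def points_act_def points_def translate_orbit)
next
  fix x y p assume a: "x \<in> carrier A" "y \<in> carrier A" "p \<in> Field points_order"
  obtain F S k where e: "p = (F, S, k)" by (metis prod_cases3)
  have F: "prime_filter F" "S \<in> orbit F" and S: "prime_filter S"
    using a orbit_prime by (auto simp: e points_def)
  interpret o: chain_action A "orbit_order F" translate by (rule chain_action_orbit[OF F(1)])
  show "points_act (x \<curlywedge> y) p \<in> {points_act x p, points_act y p}"
    using o.act_meet[OF a(1,2), of S] F by (auto simp: e points_act_def)
  show "points_act (x \<curlyvee> y) p \<in> {points_act x p, points_act y p}"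
    using o.act_join[OF a(1,2), of S] F by (auto simp: e points_act_def)
  show "(points_act x p, points_act y p) \<in> points_order" if "x \<preceq> y"
    using translate_le[OF S a(1,2) that] a F
    by (auto simp: e points_act_def points_order_iff points_le_def points_def translate_orbit)
qed (auto simp: points_def points_act_def translate_orbit translate_one orbit_subset translate_mult)

section \<open>Covers in the ordered sum, and faithfulness of the action\<close>

lemma below_points: "below points_order (F, S, k) (G, T, l) \<longleftrightarrow>
    (F, S, k) \<in> points \<and> (G, T, l) \<in> points \<and>
    (F \<noteq> G \<and> (F, G) \<in> filter_order \<or> F = G \<and> (S \<subset> T \<or> S = T \<and> k < l))"
  by (auto simp: below_def points_order_iff points_le_def)

text \<open>Over a discrete orbit only level \<open>0\<close> occurs and a different orbit lies
  entirely on one side, so nothing new comes between \<open>S\<close> and \<open>T\<close>.\<close>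

lemma covers_points_discrete:
  assumes F: "prime_filter F" "discrete F" and ST: "covers (orbit_order F) S T"
  shows "covers points_order (F, S, 0) (F, T, 0)"
proof -
  have o: "S \<in> orbit F" "T \<in> orbit F" using covers_Field[OF ST] by auto
  have "S \<subset> T" using ST by (auto simp: covers_def below_def orbit_order_iff)
  then have "below points_order (F, S, 0) (F, T, 0)" using F o by (simp add: below_points points_def)
  moreover have "((F, T, 0), d) \<in> points_order" if d: "below points_order (F, S, 0) d" for d
  proof -
    obtain G U m where e: "d = (G, U, m)" by (metis prod_cases3)
    have "T \<subseteq> U" if "F = G"
    proof -
      have "U \<in> orbit F" "S \<subset> U" using d F(2) that by (auto simp: e below_points points_def)
      then have "below (orbit_order F) S U" using o by (auto simp: below_def orbit_order_iff)
      then show ?thesis using ST below_Field[of "orbit_order F" S U] by (auto simp: covers_def orbit_order_iff)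
    qed
    then show ?thesis
      using d F o by (auto simp: e below_points points_order_iff points_le_def points_def)
  qed
  ultimately show ?thesis by (simp add: covers_def)
qed

lemma covers_points_nondiscrete:
  assumes "prime_filter F" "\<not> discrete F" "S \<in> orbit F"
  shows "covers points_order (F, S, k) (F, S, k + 1)"
  using assms by (auto simp: covers_def below_points points_def points_order_iff points_le_def)

lemma discrete_chain_points: "discrete_chain points_order"
proof
  show "Linear_order points_order" by (rule points_order_linear)
  fix p assume "p \<in> Field points_order"
  then obtain F S k where p: "p = (F, S, k)" and F: "prime_filter F" "S \<in> orbit F"
    and k: "discrete F \<Longrightarrow> k = 0" by (auto simp: points_def)
  have "(\<exists>c. covers points_order p c) \<and> (\<exists>c. covers points_order c p)"
  proof (cases "discrete F")
    case True
    then obtain T U where "covers (orbit_order F) S T" "covers (orbit_order F) U S"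
      using F(2) by (auto simp: discrete_def)
    then show ?thesis using covers_points_discrete[OF F(1) True] k[OF True] p by blast
  next
    case False
    then show ?thesis
      using covers_points_nondiscrete[OF F(1) False F(2), of k]
        covers_points_nondiscrete[OF F(1) False F(2), of "k - 1"] by (auto simp: p)
  qed
  then show "\<exists>c. covers points_order p c" "\<exists>c. covers points_order c p" by auto
qed

lemma points_faithful:
  assumes "x \<in> carrier A" "y \<in> carrier A" "x \<noteq> y"
  shows "\<exists>p \<in> points. points_act x p \<noteq> points_act y p"
proof -
  have sep: "\<exists>p \<in> points. points_act u p \<noteq> points_act v p"
    if uv: "u \<in> carrier A" "v \<in> carrier A" "\<not> u \<preceq> v" for u v
  proof -
    obtain F where F: "prime_filter F" "u \<in> F" "v \<notin> F" using prime_filter_separates[OF uv] .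
    \<comment> \<open>Membership of \<open>\<one>\<close> in the translate by \<open>u\<close> is
      membership of \<open>u\<close> in \<open>F\<close>; so the point \<open>F\<close> of its own
      orbit already tells \<open>u\<close> and \<open>v\<close> apart.\<close>
    then have "\<one> \<in> translate u F" "\<one> \<notin> translate v F" using uv by (auto simp: translate_def)
    then have "translate u F \<noteq> translate v F" by blast
    moreover have "(F, F, 0) \<in> points" using F orbit_self by (auto simp: points_def)
    ultimately show ?thesis by (intro bexI[of _ "(F, F, 0)"]) (auto simp: points_act_def)
  qed
  show ?thesis
  proof (cases "x \<preceq> y")
    case True
    then have "\<not> y \<preceq> x" using assms le_antisym by blast
    then show ?thesis using sep[OF assms(2,1)] by metis
  qed (use sep assms in blast)
qed

end

text \<open>List lengths keep the three components apart: length one for \<open>F\<close>, length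
  two for \<open>S\<close>, and at least three for the integer, which accounts for the
  \<open>+ 3\<close>. The letter \<open>undefined\<close> only serves as some element of the type,
  and the outer braces produce the second set level of \<open>chain_points\<close>.\<close>

definition code_point :: "'a set \<times> 'a set \<times> int \<Rightarrow> 'a chain_points" where
  "code_point = (\<lambda>(F, S, k).
     {(\<lambda>a. [a]) ` F \<union> (\<lambda>a. [a, a]) ` S \<union> {replicate (int_encode k + 3) undefined}})"

lemma inj_code_point: "inj code_point"
proof (rule injI)
  fix p q :: "'a set \<times> 'a set \<times> int"
  obtain F S k G T l where e: "p = (F, S, k)" "q = (G, T, l)" by (metis prod_cases3)
  let ?C = "\<lambda>F S k. (\<lambda>a. [a]) ` F \<union> (\<lambda>a. [a, a]) ` S \<union> {replicate (int_encode k + 3) (undefined :: 'a)}"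
  assume "code_point p = code_point q"
  then have eq: "?C F S k = ?C G T l" by (simp add: code_point_def e)
  have 1: "{a. [a] \<in> ?C F S k} = F" for F S and k by (auto simp: numeral_3_eq_3)
  have 2: "{a. [a, a] \<in> ?C F S k} = S" for F S and k by (auto simp: numeral_3_eq_3)
  have 3: "{xs \<in> ?C F S k. length xs \<ge> 3} = {replicate (int_encode k + 3) undefined}" for F S and k
    by (auto simp: numeral_3_eq_3)
  have "F = G" using 1[of F S k] 1[of G T l] unfolding eq by simp
  moreover have "S = T" using 2[of F S k] 2[of G T l] unfolding eq by simp
  moreover have "replicate (int_encode k + 3) (undefined :: 'a) = replicate (int_encode l + 3) undefined"
    using 3[of F S k] 3[of G T l] unfolding eq by simp
  then have "k = l" by (simp add: int_encode_eq)
  ultimately show "p = q" by (simp add: e)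
qed

theorem theorem2p7:
  fixes A :: "('a, 'm) lpregroup_scheme" and n :: nat
  assumes "n \<ge> 1"
    and "lpregroup A"
    and "periodic n A"
  shows "\<exists>(J :: 'a chain_points rel) h.
    Linear_order J \<and> lpregroup_embedding h A (Fn_chain n (lex_Z J))"
proof -
  interpret periodic_lpregroup A n
    using assms by (simp add: periodic_lpregroup_def periodic_lpregroup_axioms_def)
  interpret discrete_chain points_order by (rule discrete_chain_points)
  interpret p: chain_action A points_order points_act by (rule chain_action_points)
  \<comment> \<open>Renaming the representatives of the components by \<open>code_point\<close> puts
    \<open>J\<close> into the prescribed type.\<close>
  obtain J :: "'a chain_points rel" and \<phi>
    where bij: "bij_betw \<phi> (Field (lex_Z J)) (Field points_order)" and J: "Linear_order J"
      and iso: "\<And>u v. \<lbrakk>u \<in> Field (lex_Z J); v \<in> Field (lex_Z J)\<rbrakk> \<Longrightarrow>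
        (u, v) \<in> lex_Z J \<longleftrightarrow> (\<phi> u, \<phi> v) \<in> points_order"
    by (rule iso_lex_Z[OF inj_on_subset[OF inj_code_point subset_UNIV]]) (rule that)
  interpret q: chain_action A "lex_Z J" "\<lambda>x u. inv_into (Field (lex_Z J)) \<phi> (points_act x (\<phi> u))"
    by (rule p.transport[OF bij iso])
  have "lpregroup_embedding q.rep A (Fn_chain n (lex_Z J))"
  proof (rule q.rep_embedding)
    fix x y assume xy: "x \<in> carrier A" "y \<in> carrier A" "x \<noteq> y"
    then obtain p where p: "p \<in> points" "points_act x p \<noteq> points_act y p" using points_faithful by blast
    then have "p \<in> \<phi> ` Field (lex_Z J)" using bij by (simp add: bij_betw_def)
    then obtain u where u: "u \<in> Field (lex_Z J)" "\<phi> u = p" by blast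
    have "points_act x p \<in> \<phi> ` Field (lex_Z J)" "points_act y p \<in> \<phi> ` Field (lex_Z J)"
      using p.act_closed[OF xy(1)] p.act_closed[OF xy(2)] p(1) bij by (simp_all add: bij_betw_def)
    then have "inv_into (Field (lex_Z J)) \<phi> (points_act x p) \<noteq> inv_into (Field (lex_Z J)) \<phi> (points_act y p)"
      using p(2) inv_into_injective by metis
    then show "\<exists>u \<in> Field (lex_Z J). inv_into (Field (lex_Z J)) \<phi> (points_act x (\<phi> u))
        \<noteq> inv_into (Field (lex_Z J)) \<phi> (points_act y (\<phi> u))"
      using u by (intro bexI[of _ u]) simp_all
  qed (rule assms)
  then show ?thesis using J by blast
qed

end
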